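(* Algorithm OddElect (the explicit algorithm, together with its advice, defined in the context) solves leader election in trees $T$ with size $n$, odd diameter $D$ and $\xi(T)\le D-2$, in time $D-2$ using $O(\log n)$ bits of advice.
   Context: Trees are finite, undirected and anonymous (nodes have no labels), and are port-numbered: at each node $v$ of degree $d$ the incident edges carry distinct port numbers from $\{0,\dots,d-1\}$; there is no relation between the two port numbers of an edge at its two endpoints. The size of a tree is its number of nodes. Leader election in $T$: every node $v$ must output a sequence $P(v)=(p_1,\dots,p_k)$ of nonnegative integers. Let $P^*(v)$ be the path starting at $v$ obtained by taking $p_i$ as the outgoing port at the $i$-th node of the path. All $P^*(v)$ must be simple paths in $T$ ending at one common node (the leader). Model (LOCAL, deterministic, with advice): communication proceeds in synchronous rounds, all nodes start simultaneously, and in each round each node can exchange arbitrary messages with all its neighbours and perform arbitrary local computations. The view $V(v,r)$, which is all the information that $v$ gets about $T$ in $r$ rounds, consists of the subtree of $T$ induced by all nodes at distance at most $r$ from $v$, with all port numbers at these nodes and with the degrees of all nodes at distance exactly $r$ from $v$. An oracle knowing the entire tree provides one binary string $A$ to all nodes at the start; its length is the size of advice. The time is the number of rounds used. For a non-symmetric tree $T$ (one with no non-trivial port-preserving automorphism), $\xi(T)$ is the minimum time in which leader election in $T$ is feasible, assuming that each node is given the entire map of $T$ with all port numbers (but without the position of the node marked in the map). Notation: "path" means simple path; $d(a,b)$ is the distance; $path(a,b)$ is the path from $a$ to $b$; $seq(a,b)$ is the sequence of all ports encountered when moving from $a$ to $b$ on $path(a,b)$, and its odd-indexed terms are its outgoing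 ports. An endless path in $V(v,r)$ is a simple path of length $r$ with endpoints $v$ and $v'$ such that $v'$ is not a leaf of $T$. For odd $D$, the central edge $\{c_0,c_1\}$ is the unique edge in the middle of every simple path of length $D$. For each node $v$, $cand(v)$ is the node of $\{c_0,c_1\}$ closest to $v$. Let $h=(D-1)/2$. The gateway $g_v$ is the node in $V(v,D-2)$ furthest from $v$ such that every endless path in $V(v,D-2)$ passes through $g_v$. The tree is separated if, for each node $v$, $path(v,g_v)$ contains the central edge. Advice for OddElect: it consists of the value of $D$; the "separated bit", equal to 1 if and only if $T$ is separated; and a tuple $(j,k,m,p)$ defined as follows. If $T$ is separated, then, for $i\in\{0,1\}$, $L_i$ is the list of all port sequences (both outgoing and incoming ports, in order) that can be obtained by following simple paths starting at $c_i$ that do not contain the central edge. If $T$ is not separated, $L_i$ is the list of all port sequences (outgoing and incoming ports, in order) of length at most $2h-1$ that can be obtained by following simple paths starting at $c_i$. Each $L_i$ is sorted in ascending lexicographic order. For some $i\in\{0,1\}$ there is an integer $j$ such that the $j$-th sequence in $L_i$ does not appear in $L_{1-i}$. For this $i$ and $j$: $k$ is the largest integer such that the $j$-th sequences in $L_i$ and $L_{1-i}$ have equal prefixes of length $k$; $m$ is the $(k+1)$-th port number of the $j$-th sequence in $L_i$; $p$ is the port number that leads from $c_{1-i}$ to $c_i$. Algorithm OddElect($A$), executed at each node $v$ of $T$: Initially $e\leftarrow\emptyset$; read $D$ from $A$; $h\leftarrow(D-1)/2$; use $D-2$ rounds of communication to learn $V(v,D-2)$. Stage 1 (compute $cand(v)$).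 If $V(v,D-2)$ contains no endless paths starting at $v$: $e\leftarrow$ central edge of $V(v,D-2)$, and $cand(v)\leftarrow$ the endpoint of $e$ closest to $v$. Else: $g_v\leftarrow$ the node $w$ in $V(v,D-2)$ furthest from $v$ such that every endless path in $V(v,D-2)$ passes through $w$; if $V(v,D-2)$ contains a node $w$ such that $d(w,g_v)>d(v,g_v)$ then $\ell\leftarrow h-1$, else $\ell\leftarrow h$; $cand(v)\leftarrow$ the node on $path(v,g_v)$ at distance $\ell$ from $v$. Stage 2 (determine whether $cand(v)$ should be elected). If the separated bit is 1: if $e=\emptyset$, then $e\leftarrow$ the edge incident to $cand(v)$ that lies on all endless paths starting at $v$; compute $seq(v,v')$ for each $v'$ such that $path(v,v')$ does not contain edge $e$; $L_v\leftarrow$ the lexicographically-ordered list of all such $seq(v,v')$. Else: compute every port sequence of length at most $2h-1$ corresponding to paths starting at $cand(v)$; $L_v\leftarrow$ the lexicographically-ordered list of all such sequences. Retrieve $j,k,m$ from $A$. If the $(k+1)$-th port number of the $j$-th sequence in $L_v$ is equal to $m$, set $electMyCandidate\leftarrow true$; else set it to $false$. Stage 3 (output). If $electMyCandidate=true$, output the sequence of outgoing ports of $seq(v,cand(v))$. Else, retrieve $p$ from $A$ and output the sequence of outgoing ports of $seq(v,cand(v))$ with $p$ appended to the end.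
   Formalization: Existence of the advice is not claimed for n=4, where no j exists; in Stage 2 (separated) seq(cand(v),v') replaces seq(v,v') and e is the edge by which endless paths leave cand(v); a missing j-th sequence counts as empty; list length counts ports. *)

theory Defs
  imports Complex_Main "HOL-Library.List_Lexorder" "HOL-Library.Sublist"
begin

section \<open>Port-numbered trees\<close>

text \<open>\<open>port T u w\<close> is the port number at \<open>u\<close> of the edge \<open>{u, w}\<close>; it is meaningful only if
  that edge is present.  Node names are a device of the formalisation and are never shown to an
  algorithm (see \<open>anon\<close> below).\<close>

record 'a ptree =
  nodes :: "'a set"
  edges :: "'a set set"
  port :: "'a \<Rightarrow> 'a \<Rightarrow> nat"

definition nbrs :: "('a, 'z) ptree_scheme \<Rightarrow> 'a \<Rightarrow> 'a set" where
  "nbrs T u = {w. {u, w} \<in> edges T}"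

definition degree :: "('a, 'z) ptree_scheme \<Rightarrow> 'a \<Rightarrow> nat" where
  "degree T u = card (nbrs T u)"

definition simple_path :: "('a, 'z) ptree_scheme \<Rightarrow> 'a list \<Rightarrow> bool" where
  "simple_path T xs \<longleftrightarrow> xs \<noteq> [] \<and> distinct xs \<and> set xs \<subseteq> nodes T
     \<and> successively (\<lambda>u w. {u, w} \<in> edges T) xs"

definition path_between :: "('a, 'z) ptree_scheme \<Rightarrow> 'a \<Rightarrow> 'a \<Rightarrow> 'a list \<Rightarrow> bool" where
  "path_between T u w xs \<longleftrightarrow> simple_path T xs \<and> hd xs = u \<and> last xs = w"

definition port_tree :: "('a, 'z) ptree_scheme \<Rightarrow> bool" where
  "port_tree T \<longleftrightarrow>
     finite (nodes T) \<and> nodes T \<noteq> {} \<and>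
     (\<forall>e\<in>edges T. e \<subseteq> nodes T \<and> card e = 2) \<and>
     (\<forall>u\<in>nodes T. \<forall>w\<in>nodes T. \<exists>!xs. path_between T u w xs) \<and>
     (\<forall>u\<in>nodes T. bij_betw (port T u) (nbrs T u) {..<degree T u})"

definition tpath :: "('a, 'z) ptree_scheme \<Rightarrow> 'a \<Rightarrow> 'a \<Rightarrow> 'a list" where
  "tpath T u w = (THE xs. path_between T u w xs)"

definition tdist :: "('a, 'z) ptree_scheme \<Rightarrow> 'a \<Rightarrow> 'a \<Rightarrow> nat" where
  "tdist T u w = length (tpath T u w) - 1"

definition path_edges :: "'a list \<Rightarrow> 'a set set" where
  "path_edges xs = {{xs ! i, xs ! Suc i} | i. Suc i < length xs}"

fun all_ports :: "('a, 'z) ptree_scheme \<Rightarrow> 'a list \<Rightarrow> nat list" where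
  "all_ports T (x # y # zs) = port T x y # port T y x # all_ports T (y # zs)"
| "all_ports T _ = []"

fun out_ports :: "('a, 'z) ptree_scheme \<Rightarrow> 'a list \<Rightarrow> nat list" where
  "out_ports T (x # y # zs) = port T x y # out_ports T (y # zs)"
| "out_ports T _ = []"

definition seq :: "('a, 'z) ptree_scheme \<Rightarrow> 'a \<Rightarrow> 'a \<Rightarrow> nat list" where
  "seq T u w = all_ports T (tpath T u w)"

definition diameter :: "('a, 'z) ptree_scheme \<Rightarrow> nat" where
  "diameter T = Max {tdist T u w | u w. u \<in> nodes T \<and> w \<in> nodes T}"

text \<open>Meaningful for odd diameter only.\<close>

definition central_edge :: "('a, 'z) ptree_scheme \<Rightarrow> 'a set" where
  "central_edge T = (THE e. \<forall>xs. simple_path T xs \<and> length xs = Suc (diameter T) \<longrightarrow>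
     e = {xs ! ((diameter T - 1) div 2), xs ! Suc ((diameter T - 1) div 2)})"

definition automorphism :: "('a, 'z) ptree_scheme \<Rightarrow> ('a \<Rightarrow> 'a) \<Rightarrow> bool" where
  "automorphism T f \<longleftrightarrow> bij_betw f (nodes T) (nodes T) \<and>
     (\<forall>u\<in>nodes T. \<forall>w\<in>nodes T.
        ({f u, f w} \<in> edges T \<longleftrightarrow> {u, w} \<in> edges T) \<and>
        ({u, w} \<in> edges T \<longrightarrow> port T (f u) (f w) = port T u w))"

definition nonsymmetric :: "('a, 'z) ptree_scheme \<Rightarrow> bool" where
  "nonsymmetric T \<longleftrightarrow> (\<forall>f. automorphism T f \<longrightarrow> (\<forall>v\<in>nodes T. f v = v))"

text \<open>The path \<open>xs\<close> is $P^*(v)$ for the output \<open>P v\<close>.\<close>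

definition leader_election :: "('a, 'z) ptree_scheme \<Rightarrow> ('a \<Rightarrow> nat list) \<Rightarrow> bool" where
  "leader_election T P \<longleftrightarrow>
     (\<exists>l\<in>nodes T. \<forall>v\<in>nodes T. \<exists>xs. path_between T v l xs \<and> out_ports T xs = P v)"

section \<open>Views\<close>

text \<open>\<open>vdeg\<close> is the degree in the underlying tree.  For nodes at distance less than the radius it
  is determined by the edges of the view; for the nodes at distance exactly the radius it is the
  additional information contained in the view.\<close>

record 'a pview = "'a ptree" +
  vroot :: 'a
  vdeg :: "'a \<Rightarrow> nat"

definition local_view :: "('a, 'z) ptree_scheme \<Rightarrow> 'a \<Rightarrow> nat \<Rightarrow> 'a pview" where
  "local_view T v r =
     (let N = {w \<in> nodes T. tdist T v w \<le> r} in
      \<lparr>nodes = N, edges = {e \<in> edges T. e \<subseteq> N}, port = port T, vroot = v, vdeg = degree T\<rparr>)"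

text \<open>Anonymisation: every node is renamed to the sequence of outgoing ports leading to it from the
  root.  These names carry no information beyond the port numbers, so that two views have the same
  anonymisation iff they are isomorphic as rooted port-numbered trees with degrees.  Ports of
  non-edges and degrees of non-nodes are set to \<open>0\<close>, since otherwise they could leak information
  about the underlying tree.\<close>

definition anon :: "'a pview \<Rightarrow> nat list pview" where
  "anon V =
     (let f = (\<lambda>w. out_ports V (tpath V (vroot V) w));
          g = inv_into (nodes V) f;
          N = f ` nodes V;
          E = (\<lambda>e. f ` e) ` edges V
      in \<lparr>nodes = N, edges = E,
          port = (\<lambda>x y. if {x, y} \<in> E then port V (g x) (g y) else 0),
          vroot = f (vroot V),
          vdeg = (\<lambda>x. if x \<in> N then vdeg V (g x) else 0)\<rparr>)"

definition view :: "('a, 'z) ptree_scheme \<Rightarrow> 'a \<Rightarrow> nat \<Rightarrow> nat list pview" where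
  "view T v r = anon (local_view T v r)"

text \<open>A deterministic \<open>r\<close>-round algorithm is an arbitrary function of the view of radius \<open>r\<close>.
  As \<open>alg\<close> is chosen after \<open>T\<close>, it may use the entire map of \<open>T\<close>.\<close>

definition feasible_with_map :: "('a, 'z) ptree_scheme \<Rightarrow> nat \<Rightarrow> bool" where
  "feasible_with_map T r \<longleftrightarrow>
     (\<exists>alg :: nat list pview \<Rightarrow> nat list. leader_election T (\<lambda>v. alg (view T v r)))"

definition xi :: "('a, 'z) ptree_scheme \<Rightarrow> nat" where
  "xi T = (LEAST r. feasible_with_map T r)"

text \<open>In \<open>endless r V\<close>, \<open>gateway r V\<close> the number \<open>r\<close> is the radius of \<open>V\<close>.
  If there are no endless paths, the condition on gateways is vacuous and the gateways are the
  nodes furthest from the root; otherwise the gateway is unique.\<close>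

definition endless :: "nat \<Rightarrow> 'a pview \<Rightarrow> 'a list \<Rightarrow> bool" where
  "endless r V xs \<longleftrightarrow>
     simple_path V xs \<and> hd xs = vroot V \<and> length xs = Suc r \<and> vdeg V (last xs) \<noteq> 1"

definition gateway :: "nat \<Rightarrow> 'a pview \<Rightarrow> 'a \<Rightarrow> bool" where
  "gateway r V g \<longleftrightarrow>
     is_arg_max (tdist V (vroot V))
       (\<lambda>w. w \<in> nodes V \<and> (\<forall>xs. endless r V xs \<longrightarrow> w \<in> set xs)) g"

definition separated :: "('a, 'z) ptree_scheme \<Rightarrow> bool" where
  "separated T \<longleftrightarrow>
     (\<forall>v\<in>nodes T. \<forall>g. gateway (diameter T - 2) (local_view T v (diameter T - 2)) g \<longrightarrow>
        central_edge T \<in> path_edges (tpath T v g))"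

section \<open>The advice\<close>

text \<open>Positions are counted from 1.  A list with fewer than \<open>j\<close> entries is regarded as having the
  empty sequence as its \<open>j\<close>-th entry; this case cannot be avoided, as one of the two lists of the
  oracle may be an initial segment of the other.\<close>

definition jth :: "nat list list \<Rightarrow> nat \<Rightarrow> nat list" where
  "jth L j = (if 1 \<le> j \<and> j \<le> length L then L ! (j - 1) else [])"

text \<open>In the non-separated case the length counts ports, not edges: a sequence of
  odd length ends with the outgoing port of the last edge.\<close>

definition oracle_list :: "('a, 'z) ptree_scheme \<Rightarrow> 'a \<Rightarrow> nat list list" where
  "oracle_list T c = sorted_list_of_set
     (if separated T
      then {seq T c w | w. w \<in> nodes T \<and> central_edge T \<notin> path_edges (tpath T c w)}
      else {s. length s \<le> 2 * ((diameter T - 1) div 2) - 1 \<and> (\<exists>w\<in>nodes T. prefix s (seq T c w))})"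

record advice =
  adv_D :: nat
  adv_sep :: bool
  adv_j :: nat
  adv_k :: nat
  adv_m :: nat
  adv_p :: nat

text \<open>Here \<open>a\<close> is $c_i$ and \<open>b\<close> is $c_{1-i}$.  The oracle is free to choose \<open>i\<close> and \<open>j\<close>, hence
  a predicate.  Beware that no suitable \<open>i\<close>, \<open>j\<close> exist if \<open>T\<close> is a path with four nodes: no path
  with four nodes is separated, and both lists are \<open>[[], [0], [1]]\<close>; still, leader election in time
  \<open>D - 2 = 1\<close> is feasible in it with the map if the two ports of the central edge differ.\<close>

definition advice_for :: "('a, 'z) ptree_scheme \<Rightarrow> advice \<Rightarrow> bool" where
  "advice_for T adv \<longleftrightarrow>
     adv_D adv = diameter T \<and> (adv_sep adv \<longleftrightarrow> separated T) \<and>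
     (\<exists>a b. a \<noteq> b \<and> central_edge T = {a, b} \<and>
        1 \<le> adv_j adv \<and> adv_j adv \<le> length (oracle_list T a) \<and>
        (let s = jth (oracle_list T a) (adv_j adv); t = jth (oracle_list T b) (adv_j adv) in
         s \<notin> set (oracle_list T b) \<and>
         adv_k adv = (GREATEST k. k \<le> length s \<and> k \<le> length t \<and> take k s = take k t) \<and>
         adv_m adv = s ! adv_k adv \<and>
         adv_p adv = port T b a))"

text \<open>Self-delimiting binary code for natural numbers: each binary digit, least significant first,
  is preceded by a \<open>True\<close>; the end is marked by a \<open>False\<close>.\<close>

fun enc_nat :: "nat \<Rightarrow> bool list" where
  "enc_nat n = (if n = 0 then [False] else True # odd n # enc_nat (n div 2))"

declare enc_nat.simps [simp del]

fun dec_nat :: "bool list \<Rightarrow> nat \<times> bool list" where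
  "dec_nat (True # b # bs) = (let (n, rest) = dec_nat bs in (of_bool b + 2 * n, rest))"
| "dec_nat [True] = (0, [])"
| "dec_nat (False # bs) = (0, bs)"
| "dec_nat [] = (0, [])"

definition enc_advice :: "advice \<Rightarrow> bool list" where
  "enc_advice adv = adv_sep adv #
     concat (map enc_nat [adv_D adv, adv_j adv, adv_k adv, adv_m adv, adv_p adv])"

definition dec_advice :: "bool list \<Rightarrow> advice" where
  "dec_advice A =
     (let (D, A1) = dec_nat (tl A); (j, A2) = dec_nat A1; (k, A3) = dec_nat A2;
          (m, A4) = dec_nat A3; (p, A5) = dec_nat A4
      in \<lparr>adv_D = D, adv_sep = hd A, adv_j = j, adv_k = k, adv_m = m, adv_p = p\<rparr>)"

definition OddElect_advice :: "('a, 'z) ptree_scheme \<Rightarrow> bool list \<Rightarrow> bool" where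
  "OddElect_advice T A \<longleftrightarrow> (\<exists>adv. advice_for T adv \<and> A = enc_advice adv)"

section \<open>Algorithm OddElect\<close>

definition OddElect_rounds :: "bool list \<Rightarrow> nat" where
  "OddElect_rounds A = adv_D (dec_advice A) - 2"

text \<open>Stage 1 yields the value of the variable \<open>e\<close> (initially empty) and the candidate.\<close>

definition stage1 :: "nat \<Rightarrow> 'a pview \<Rightarrow> 'a set \<times> 'a" where
  "stage1 D V =
     (let v = vroot V; h = (D - 1) div 2 in
      if \<not> (\<exists>xs. endless (D - 2) V xs)
      then let e = central_edge V in (e, THE c. is_arg_min (tdist V v) (\<lambda>c. c \<in> e) c)
      else let g = (THE g. gateway (D - 2) V g);
               l = (if \<exists>w\<in>nodes V. tdist V w g > tdist V v g then h - 1 else h)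
           in ({}, tpath V v g ! l))"

text \<open>If \<open>v \<noteq> c\<close>, the edge through which the path from \<open>v\<close> enters the candidate \<open>c\<close> also lies on all
  endless paths; the edge meant here is the one through which they leave \<open>c\<close>.\<close>

definition exit_edge :: "nat \<Rightarrow> 'a pview \<Rightarrow> 'a \<Rightarrow> 'a set" where
  "exit_edge D V c = (THE e. e \<in> edges V \<and> c \<in> e \<and>
     (\<forall>xs. endless (D - 2) V xs \<longrightarrow> e \<in> path_edges xs) \<and>
     e \<notin> path_edges (tpath V (vroot V) c))"

text \<open>In the non-separated case a sequence of odd length may end with a port of a node \<open>w\<close> on the
  boundary of the view.  The edge with this port is not part of the view, but the available ports
  are known from the degree of \<open>w\<close>.  The path has to be simple, so this port must differ from the
  one through which \<open>w\<close> was entered.\<close>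

definition stage2_list :: "nat \<Rightarrow> bool \<Rightarrow> 'a pview \<Rightarrow> 'a set \<Rightarrow> 'a \<Rightarrow> nat list list" where
  "stage2_list D sep V e c = sorted_list_of_set
     (if sep
      then let e' = (if e = {} then exit_edge D V c else e)
           in {seq V c w | w. w \<in> nodes V \<and> e' \<notin> path_edges (tpath V (vroot V) w)}
      else {s. length s \<le> 2 * ((D - 1) div 2) - 1 \<and>
               (\<exists>w\<in>nodes V. s = seq V c w \<or>
                  (\<exists>q<vdeg V w. (w = c \<or> q \<noteq> last (seq V c w)) \<and> s = seq V c w @ [q]))})"

definition OddElect :: "bool list \<Rightarrow> 'a pview \<Rightarrow> nat list" where
  "OddElect A V =
     (let adv = dec_advice A; D = adv_D adv;
          (e, c) = stage1 D V;
          s = jth (stage2_list D (adv_sep adv) V e c) (adv_j adv);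
          electMyCandidate = (adv_k adv < length s \<and> s ! adv_k adv = adv_m adv);
          outs = out_ports V (tpath V (vroot V) c)
      in if electMyCandidate then outs else outs @ [adv_p adv])"

end

theory Submission
  imports Defs
begin

text \<open>
  Let \<open>D = 2 * h + 1\<close> and let \<open>{a, b}\<close> be the central edge; removing it leaves two sides of depth \<open>h\<close>.
  From a node \<open>v\<close> on the side of \<open>a\<close>, an endless path of length \<open>D - 2\<close> always passes through \<open>a\<close>,
  and there is none unless \<open>v\<close> has distance \<open>h\<close> or \<open>h - 1\<close> from \<open>a\<close>; in the latter case it also
  crosses the central edge.  Hence Stage 1 finds \<open>a\<close>.  Stage 2 then reproduces the list of the
  oracle for \<open>a\<close>, so all nodes agree on which end of the central edge is elected.

  The feasibility of leader election with the map is needed only for the two lists of the oracle to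
  differ.  If they agree, there are nodes \<open>u\<close> and \<open>w\<close> on different sides, at equal distances from \<open>a\<close>
  and from \<open>b\<close>, with the same view: \<open>a\<close> and \<open>b\<close> themselves if the tree is separated, and otherwise
  two deepest leaves, in branches that are reached through a common port of \<open>a\<close> and \<open>b\<close> that is not
  a port of the central edge.  The outputs of \<open>u\<close> and \<open>w\<close> then have the same length, which is
  impossible, as no node has the same distance from \<open>u\<close> and \<open>w\<close>.
\<close>

section \<open>Paths and ports\<close>

text \<open>If the tree is separated, the lists cover both sides completely, so equal lists give
  \<open>a\<close> and \<open>b\<close> equal views of every radius. Otherwise they stop at length
  \<open>2 * h - 1\<close>: the port leading to a node at distance \<open>h\<close> is recorded, but
  not the port by which it is entered. This gap is why deepest leaves \<open>v\<close> and
  \<open>w\<close> are compared instead of \<open>a\<close> and \<open>b\<close>. Within distance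
  \<open>2 * h - 1\<close> of \<open>v\<close>, nodes at distance \<open>h\<close> or more from
  \<open>a\<close> occur only in the branch of \<open>v\<close>; they are leaves, so the missing
  port is 0. All other visible nodes are nearer to \<open>a\<close>, where the lists determine
  sequences and degrees. The common port must be central at neither end, so that both branches stay
  on their own sides. If \<open>h > 1\<close>, failure of separation supplies two deep branches on
  one side, at most one of which starts with the central port of the other end. If
  \<open>h = 1\<close>, equal lists mean equal degrees, and a third port can be missing only when
  both degrees are 2, that is, with four nodes.\<close>

lemma simple_path_rev: "simple_path T (rev xs) \<longleftrightarrow> simple_path T xs"
  by (simp add: simple_path_def successively_rev insert_commute)

lemma simple_path_append:
  "simple_path T (xs @ y # ys) \<longleftrightarrow>
     simple_path T (xs @ [y]) \<and> simple_path T (y # ys) \<and> set xs \<inter> set (y # ys) = {}"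
  by (auto simp: simple_path_def successively_append_iff)

lemma path_between_rev: "path_between T u w (rev xs) \<longleftrightarrow> path_between T w u xs"
proof (cases "xs = []")
  case True
  then show ?thesis by (simp add: path_between_def simple_path_def)
qed (auto simp: path_between_def simple_path_rev hd_rev last_rev)

lemma path_edges_Cons: "path_edges (x # y # zs) = insert {x, y} (path_edges (y # zs))"
  unfolding path_edges_def
proof (intro set_eqI iffI; elim insertE CollectE exE conjE)
  fix e i assume "e = {(x # y # zs) ! i, (x # y # zs) ! Suc i}" "Suc i < length (x # y # zs)"
  then show "e \<in> insert {x, y} {{(y # zs) ! i, (y # zs) ! Suc i} |i. Suc i < length (y # zs)}"
    by (cases i) auto
next
  fix e assume "e = {x, y}"
  then show "e \<in> {{(x # y # zs) ! i, (x # y # zs) ! Suc i} |i. Suc i < length (x # y # zs)}"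
    by (intro CollectI exI[of _ 0]) auto
next
  fix e i assume "e = {(y # zs) ! i, (y # zs) ! Suc i}" "Suc i < length (y # zs)"
  then show "e \<in> {{(x # y # zs) ! i, (x # y # zs) ! Suc i} |i. Suc i < length (x # y # zs)}"
    by (intro CollectI exI[of _ "Suc i"]) auto
qed

lemma path_edges_short [simp]: "path_edges [] = {}" "path_edges [x] = {}"
  by (auto simp: path_edges_def)

lemma path_edges_append: "path_edges (xs @ y # ys) = path_edges (xs @ [y]) \<union> path_edges (y # ys)"
proof (induction xs)
  case (Cons x xs)
  then show ?case by (cases xs) (auto simp: path_edges_Cons)
qed simp

lemma path_edges_subset: "e \<in> path_edges xs \<Longrightarrow> e \<subseteq> set xs"
  by (auto simp: path_edges_def)

lemma path_edges_map: "path_edges (map f xs) = (`) f ` path_edges xs"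
proof (induction xs rule: induct_list012)
  case (3 x y zs)
  then show ?case by (simp add: path_edges_Cons)
qed simp_all

lemma all_ports_append: "all_ports T (xs @ y # ys) = all_ports T (xs @ [y]) @ all_ports T (y # ys)"
  by (induction xs rule: induct_list012) auto

lemma out_ports_append: "out_ports T (xs @ y # ys) = out_ports T (xs @ [y]) @ out_ports T (y # ys)"
  by (induction xs rule: induct_list012) auto

lemma all_ports_rev: "all_ports T (rev xs) = rev (all_ports T xs)"
proof (induction xs rule: induct_list012)
  case (3 x y zs)
  then show ?case by (simp add: all_ports_append[of T "rev zs" y "[x]"])
qed simp_all

lemma length_all_ports: "length (all_ports T xs) = 2 * (length xs - 1)"
  by (induction xs rule: induct_list012) auto

lemma length_out_ports: "length (out_ports T xs) = length xs - 1"
  by (induction xs rule: induct_list012) auto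

lemma take_all_ports: "take (2 * k) (all_ports T xs) = all_ports T (take (Suc k) xs)"
proof (induction xs arbitrary: k rule: induct_list012)
  case (3 x y zs)
  then show ?case by (cases k) auto
qed auto

text \<open>Drops the incoming ports of a full port sequence, so that facts about outgoing ports
  follow from facts about \<open>all_ports\<close> and \<open>seq\<close>.\<close>

fun evens :: "'a list \<Rightarrow> 'a list" where
  "evens (x # y # zs) = x # evens zs"
| "evens xs = xs"

lemma out_ports_conv: "out_ports T xs = evens (all_ports T xs)"
  by (induction xs rule: induct_list012) auto

section \<open>Paths in trees\<close>

locale tree =
  fixes T :: "'a ptree"
  assumes port_tree: "port_tree T"
begin

abbreviation "N \<equiv> nodes T"
abbreviation "adj u w \<equiv> {u, w} \<in> edges T"
abbreviation "path \<equiv> tpath T"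
abbreviation "d \<equiv> tdist T"

lemma finite_nodes: "finite N" and nodes_ne: "N \<noteq> {}"
  using port_tree by (auto simp: port_tree_def)

lemma adj_nodes: assumes "adj u w" shows "u \<in> N" "w \<in> N" "u \<noteq> w"
proof -
  have "{u, w} \<subseteq> N" "card {u, w} = 2" using assms port_tree by (auto simp: port_tree_def)
  then show "u \<in> N" "w \<in> N" "u \<noteq> w" by auto
qed

lemma adj_commute: "adj u w \<longleftrightarrow> adj w u"
  by (simp add: insert_commute)

lemma path_between_nodes: "path_between T u w xs \<Longrightarrow> u \<in> N \<and> w \<in> N"
  by (auto simp: path_between_def simple_path_def)

lemma path_between_iff:
  assumes "u \<in> N" "w \<in> N"
  shows "path_between T u w xs \<longleftrightarrow> xs = path u w"
proof -
  have "\<exists>!xs. path_between T u w xs" using assms port_tree by (auto simp: port_tree_def)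
  then show ?thesis unfolding tpath_def by (metis the_equality)
qed

lemma path_eqI: "path_between T u w xs \<Longrightarrow> path u w = xs"
  using path_between_iff path_between_nodes by metis

lemma simple_path_eq: "simple_path T xs \<Longrightarrow> path (hd xs) (last xs) = xs"
  by (rule path_eqI) (simp add: path_between_def)

lemma path_props:
  assumes "u \<in> N" "w \<in> N"
  shows "simple_path T (path u w)" "hd (path u w) = u" "last (path u w) = w" "path u w \<noteq> []"
    "u \<in> set (path u w)" "w \<in> set (path u w)" "set (path u w) \<subseteq> N" "distinct (path u w)"
proof -
  have "path_between T u w (path u w)" using path_between_iff[OF assms] by simp
  then show "simple_path T (path u w)" "hd (path u w) = u" "last (path u w) = w" "path u w \<noteq> []"
    "u \<in> set (path u w)" "w \<in> set (path u w)" "set (path u w) \<subseteq> N" "distinct (path u w)"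
    using hd_in_set[of "path u w"] last_in_set[of "path u w"]
    by (auto simp: path_between_def simple_path_def)
qed

lemma path_self [simp]: "u \<in> N \<Longrightarrow> path u u = [u]"
  by (rule path_eqI) (simp add: path_between_def simple_path_def)

lemma path_adj: "adj u w \<Longrightarrow> path u w = [u, w]"
  using adj_nodes by (intro path_eqI) (auto simp: path_between_def simple_path_def)

lemma path_rev: "u \<in> N \<Longrightarrow> w \<in> N \<Longrightarrow> path w u = rev (path u w)"
  by (rule path_eqI) (simp add: path_between_rev path_between_iff)

lemma length_path: "u \<in> N \<Longrightarrow> w \<in> N \<Longrightarrow> length (path u w) = Suc (d u w)"
  using path_props(4)[of u w] by (cases "path u w") (auto simp: tdist_def)

lemma path_append:
  assumes "u \<in> N" "w \<in> N" "path u w = xs @ y # ys"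
  shows "path u y = xs @ [y]" "path y w = y # ys"
proof -
  have sp: "simple_path T (xs @ [y])" "simple_path T (y # ys)"
    using path_props(1)[OF assms(1,2)] simple_path_append[of T xs y ys] assms(3) by auto
  have "hd (xs @ [y]) = u" "last (y # ys) = w"
    using path_props(2,3)[OF assms(1,2)] assms(3) by (auto simp: hd_append)
  then show "path u y = xs @ [y]" "path y w = y # ys"
    using simple_path_eq[OF sp(1)] simple_path_eq[OF sp(2)] by auto
qed

lemma path_split:
  assumes "u \<in> N" "w \<in> N" "y \<in> set (path u w)"
  obtains xs ys where "path u w = xs @ y # ys" "path u y = xs @ [y]" "path y w = y # ys"
  using assms split_list[of y "path u w"] path_append by metis

lemma on_path_nodes: "u \<in> N \<Longrightarrow> w \<in> N \<Longrightarrow> y \<in> set (path u w) \<Longrightarrow> y \<in> N"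
  using path_props(7) by blast

lemma dist_on_path:
  assumes "u \<in> N" "w \<in> N" "y \<in> set (path u w)"
  shows "d u w = d u y + d y w"
proof -
  obtain xs ys where "path u w = xs @ y # ys" "path u y = xs @ [y]" "path y w = y # ys"
    using path_split[OF assms] .
  then show ?thesis by (simp add: tdist_def)
qed

lemma dist_self [simp]: "u \<in> N \<Longrightarrow> d u u = 0"
  by (simp add: tdist_def)

lemma dist_commute: "u \<in> N \<Longrightarrow> w \<in> N \<Longrightarrow> d u w = d w u"
  by (simp add: tdist_def path_rev[of w u])

lemma dist_eq_0: assumes "u \<in> N" "w \<in> N" shows "d u w = 0 \<longleftrightarrow> u = w"
proof
  assume "d u w = 0"
  then have "length (path u w) = 1" using length_path[OF assms] by simp
  then obtain x where "path u w = [x]" by (auto simp: length_Suc_conv)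
  then show "u = w" using path_props(2,3)[OF assms] by simp
qed (use assms in simp)

text \<open>By uniqueness of paths every edge points away from \<open>u\<close> or back to it: if
  \<open>x\<close> is on the path to \<open>w\<close>, the rest of that path must be the edge
  itself.\<close>

lemma path_step:
  assumes "u \<in> N" "adj w x"
  shows "path u x = path u w @ [x] \<or> path u w = path u x @ [w]"
proof (cases "x \<in> set (path u w)")
  case True
  have wx: "w \<in> N" "x \<in> N" using adj_nodes[OF assms(2)] by auto
  obtain xs ys where "path u w = xs @ x # ys" "path u x = xs @ [x]" "path x w = x # ys"
    using path_split[OF assms(1) wx(1) True] .
  then show ?thesis using path_adj[of x w] assms(2) by (auto simp: insert_commute)
next
  case False
  have wx: "w \<in> N" "x \<in> N" using adj_nodes[OF assms(2)] by auto
  note p = path_props[OF assms(1) wx(1)]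
  have "path_between T u x (path u w @ [x])"
    using p False wx assms(2) by (auto simp: path_between_def simple_path_def successively_append_iff)
  then show ?thesis using path_eqI by blast
qed

text \<open>\<open>m\<close> is the median of the three nodes, the last common node of the two paths
  from \<open>c\<close>. The remainders \<open>P\<close> and \<open>Q\<close> are disjoint, since a
  common node would have a unique path from \<open>c\<close> and hence force equal heads; so they
  can be glued at \<open>m\<close>.\<close>

lemma path_fork:
  assumes "c \<in> N" "u \<in> N" "w \<in> N"
  obtains R m P Q where "path c u = R @ m # P" "path c w = R @ m # Q" "path u w = rev P @ m # Q"
    "P \<noteq> [] \<Longrightarrow> Q \<noteq> [] \<Longrightarrow> hd P \<noteq> hd Q"
proof -
  define X where "X = longest_common_prefix (path c u) (path c w)"
  obtain P Q where PQ: "path c u = X @ P" "path c w = X @ Q"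
    using longest_common_prefix_prefix1 longest_common_prefix_prefix2 unfolding X_def
    by (metis prefixE)
  have ne: "P = [] \<or> Q = [] \<or> hd P \<noteq> hd Q"
  proof (rule ccontr)
    assume "\<not> ?thesis"
    then obtain x P' Q' where "P = x # P'" "Q = x # Q'"
      by (metis list.collapse)
    then have "prefix (X @ [x]) (path c u)" "prefix (X @ [x]) (path c w)"
      using PQ by auto
    then have "prefix (X @ [x]) X"
      unfolding X_def by (rule longest_common_prefix_max_prefix)
    then show False using prefix_length_le by fastforce
  qed
  have "X \<noteq> []"
  proof
    assume "X = []"
    then have "hd P = c" "hd Q = c" "P \<noteq> []" "Q \<noteq> []"
      using PQ path_props(2,4) assms by auto
    then show False using ne by simp
  qed
  then obtain R m where X: "X = R @ [m]" by (metis rev_exhaust)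
  have eq: "path c u = R @ m # P" "path c w = R @ m # Q" using PQ X by auto
  have m: "path m u = m # P" "path m w = m # Q"
    using path_append(2)[OF assms(1,2) eq(1)] path_append(2)[OF assms(1,3) eq(2)] by auto
  have disj: "set P \<inter> set Q = {}"
  proof (rule ccontr)
    assume "set P \<inter> set Q \<noteq> {}"
    then obtain y where y: "y \<in> set P" "y \<in> set Q" by auto
    obtain P1 P2 where P: "P = P1 @ y # P2" using split_list[OF y(1)] by auto
    obtain Q1 Q2 where Q: "Q = Q1 @ y # Q2" using split_list[OF y(2)] by auto
    have "path c y = R @ m # P1 @ [y]" using path_append(1)[of c u "R @ m # P1" y P2] eq P assms by auto
    moreover have "path c y = R @ m # Q1 @ [y]" using path_append(1)[of c w "R @ m # Q1" y Q2] eq Q assms by auto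
    ultimately have "P1 = Q1" by simp
    then have "hd P = hd Q" using P Q by (cases P1) auto
    then show False using ne P Q by auto
  qed
  have "m \<in> N" using on_path_nodes[of c u m] assms eq by auto
  have s: "simple_path T (m # P)" "simple_path T (m # Q)"
    using path_props(1)[OF \<open>m \<in> N\<close> assms(2)] path_props(1)[OF \<open>m \<in> N\<close> assms(3)] m by auto
  have "simple_path T (rev P @ m # Q)"
    using s disj simple_path_rev[of T "m # P"] by (subst simple_path_append) (auto simp: simple_path_def)
  moreover have "hd (rev P @ m # Q) = u"
    using path_props(3)[OF \<open>m \<in> N\<close> assms(2)] m by (cases "P = []") (auto simp: hd_append hd_rev)
  moreover have "last (rev P @ m # Q) = w" using path_props(3)[OF \<open>m \<in> N\<close> assms(3)] m by simp
  ultimately have "path u w = rev P @ m # Q" by (intro path_eqI) (auto simp: path_between_def)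
  then show ?thesis using that[of R m P Q] eq ne by blast
qed

lemma path_fork_subset:
  assumes "c \<in> N" "u \<in> N" "w \<in> N"
  shows "set (path u w) \<subseteq> set (path c u) \<union> set (path c w)"
proof -
  obtain R m P Q where "path c u = R @ m # P" "path c w = R @ m # Q" "path u w = rev P @ m # Q"
    by (rule path_fork[OF assms])
  then show ?thesis by auto
qed

lemma dist_triangle:
  assumes "u \<in> N" "c \<in> N" "w \<in> N"
  shows "d u w \<le> d u c + d c w"
proof -
  obtain R m P Q where "path c u = R @ m # P" "path c w = R @ m # Q" "path u w = rev P @ m # Q"
    by (rule path_fork[OF assms(2,1,3)])
  then show ?thesis using dist_commute[OF assms(1,2)] by (simp add: tdist_def)
qed

lemma on_path_iff:
  assumes "u \<in> N" "c \<in> N" "w \<in> N"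
  shows "c \<in> set (path u w) \<longleftrightarrow> d u w = d u c + d c w"
proof
  assume "d u w = d u c + d c w"
  moreover obtain R m P Q where *: "path c u = R @ m # P" "path c w = R @ m # Q" "path u w = rev P @ m # Q"
    using path_fork[OF assms(2,1,3)] .
  ultimately have "R = []" using dist_commute[of u c] assms by (auto simp: tdist_def)
  then have "m = c" using path_props(2)[of c u] * assms by auto
  then show "c \<in> set (path u w)" using * by simp
qed (use dist_on_path assms in blast)

text \<open>The path lies in the union of the paths from \<open>v\<close> to its ends. Hence a view
  contains, with any two nodes, the whole path between them.\<close>

lemma ball_convex:
  assumes "v \<in> N" "u \<in> N" "w \<in> N" "d v u \<le> r" "d v w \<le> r" "y \<in> set (path u w)"
  shows "d v y \<le> r"
proof -
  have "y \<in> set (path v u) \<union> set (path v w)" using path_fork_subset assms by blast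
  then have "d v y \<le> d v u \<or> d v y \<le> d v w" using dist_on_path[of v _ y] assms by fastforce
  then show ?thesis using assms by linarith
qed

lemma path_nth:
  assumes "u \<in> N" "w \<in> N" "z \<in> set (path u w)"
  shows "path u w ! d u z = z"
proof -
  obtain xs ys where "path u w = xs @ z # ys" "path u z = xs @ [z]" by (rule path_split[OF assms])
  then show ?thesis by (simp add: tdist_def)
qed

lemma on_path_eq:
  assumes "u \<in> N" "w \<in> N" "x \<in> set (path u w)" "y \<in> set (path u w)" "d u x = d u y"
  shows "x = y"
  using path_nth[OF assms(1-3)] path_nth[OF assms(1,2,4)] assms(5) by metis

lemma on_path_le:
  assumes "u \<in> N" "w \<in> N" "x \<in> set (path u w)" "y \<in> set (path u w)" "d u x \<le> d u y"
  shows "x \<in> set (path u y)"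
proof -
  obtain xs ys where s: "path u w = xs @ y # ys" "path u y = xs @ [y]" "path y w = y # ys"
    using path_split[OF assms(1,2,4)] .
  have "path u w ! d u x = x" using path_nth assms by blast
  moreover have "d u x \<le> length xs" using s assms(5) by (simp add: tdist_def)
  ultimately have "x = (xs @ [y]) ! d u x" using s(1) by (auto simp: nth_append split: if_splits)
  then show ?thesis using s(2) \<open>d u x \<le> length xs\<close>
    by (metis le_imp_less_Suc length_append_singleton nth_mem)
qed

lemma node_at_dist:
  assumes "u \<in> N" "w \<in> N" "k \<le> d u w"
  shows "path u w ! k \<in> N" "path u w ! k \<in> set (path u w)" "d u (path u w ! k) = k"
    "path u (path u w ! k) = take (Suc k) (path u w)"
proof -
  have k: "k < length (path u w)" using assms length_path[of u w] by simp
  show *: "path u w ! k \<in> set (path u w)" using k by simp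
  then show "path u w ! k \<in> N" using on_path_nodes assms by blast
  have "path u w = take k (path u w) @ path u w ! k # drop (Suc k) (path u w)"
    using id_take_nth_drop[OF k] .
  then show **: "path u (path u w ! k) = take (Suc k) (path u w)"
    using path_append(1)[OF assms(1,2)] k by (metis take_Suc_conv_app_nth)
  then show "d u (path u w ! k) = k" using k by (simp add: tdist_def)
qed

lemma path_last_step:
  assumes "u \<in> N" "w \<in> N" "u \<noteq> w"
  obtains y where "adj y w" "path u w = path u y @ [w]" "y \<in> N"
proof -
  have "d u w \<noteq> 0" using dist_eq_0 assms by simp
  then have "length (path u w) \<ge> 2" using length_path assms by simp
  obtain ys where ys: "path u w = ys @ [w]"
    using path_props(3,4)[of u w] assms by (metis append_butlast_last_id)
  then have "ys \<noteq> []" using \<open>length (path u w) \<ge> 2\<close> by auto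
  then obtain zs y where zs: "ys = zs @ [y]" by (metis rev_exhaust)
  have "path u y = zs @ [y]" "path y w = [y, w]" using path_append[of u w zs y "[w]"] assms ys zs by auto
  moreover have "y \<in> N" using on_path_nodes[of u w y] assms ys zs by simp
  moreover have "adj y w" using path_props(1)[of u w] assms ys zs by (auto simp: simple_path_def successively_append_iff)
  ultimately show ?thesis using that ys zs by simp
qed

section \<open>Port sequences as addresses of nodes\<close>

lemma bij_port: "u \<in> N \<Longrightarrow> bij_betw (port T u) (nbrs T u) {..<degree T u}"
  using port_tree by (auto simp: port_tree_def)

lemma port_inj: "adj u w \<Longrightarrow> adj u x \<Longrightarrow> port T u w = port T u x \<Longrightarrow> w = x"
  using bij_port[of u] adj_nodes[of u w] unfolding bij_betw_def inj_on_def nbrs_def by blast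

lemma port_less: "adj u w \<Longrightarrow> port T u w < degree T u"
  using bij_port[of u] adj_nodes[of u w] unfolding bij_betw_def nbrs_def by auto

lemma port_surj: assumes "u \<in> N" "q < degree T u" obtains w where "adj u w" "port T u w = q"
proof -
  have "q \<in> port T u ` nbrs T u" using bij_port[OF assms(1)] assms(2) unfolding bij_betw_def by auto
  then show ?thesis using that unfolding nbrs_def by auto
qed

lemma finite_nbrs: "finite (nbrs T u)"
  by (rule finite_subset[OF _ finite_nodes]) (use adj_nodes in \<open>auto simp: nbrs_def\<close>)

lemma degree_le: "degree T u \<le> card N"
  unfolding degree_def by (rule card_mono) (use finite_nodes adj_nodes in \<open>auto simp: nbrs_def\<close>)

text \<open>Ports at a node are distinct, so each outgoing port fixes the next node. This is what
  makes the renaming in \<open>anon\<close> injective.\<close>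

lemma walk_inj:
  assumes "successively adj xs" "successively adj ys" "xs \<noteq> []" "ys \<noteq> []" "hd xs = hd ys"
    "out_ports T xs = out_ports T ys"
  shows "xs = ys"
  using assms
proof (induction xs arbitrary: ys rule: induct_list012)
  case (2 x)
  then show ?case by (cases ys rule: remdups_adj.cases) auto
next
  case (3 x y zs)
  then obtain y' zs' where ys: "ys = x # y' # zs'" by (cases ys rule: remdups_adj.cases) auto
  then have "y = y'" using 3 port_inj by auto
  then have "y # zs = y' # zs'" using 3 ys by (intro "3.IH"(2)) auto
  then show ?case using ys by simp
qed simp

lemma out_ports_inj:
  assumes "v \<in> N" "u \<in> N" "w \<in> N" "out_ports T (path v u) = out_ports T (path v w)"
  shows "u = w"
proof -
  have "path v u = path v w"
    using path_props[OF assms(1,2)] path_props[OF assms(1,3)] assms(4)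
    by (intro walk_inj) (auto simp: simple_path_def)
  then show ?thesis using path_props(3) assms by metis
qed

lemma seq_inj:
  assumes "v \<in> N" "u \<in> N" "w \<in> N" "seq T v u = seq T v w"
  shows "u = w"
  using out_ports_inj[OF assms(1-3)] assms(4) by (simp add: out_ports_conv seq_def)

lemma length_seq: "length (seq T u w) = 2 * d u w"
  by (simp add: seq_def length_all_ports tdist_def)

lemma seq_step:
  assumes "u \<in> N" "adj w x" "path u x = path u w @ [x]"
  shows "seq T u x = seq T u w @ [port T w x, port T x w]"
proof -
  have "w \<in> N" using adj_nodes assms by blast
  then obtain xs where "path u w = xs @ [w]"
    using path_props(3,4)[of u w] assms(1) by (metis append_butlast_last_id)
  then show ?thesis unfolding seq_def assms(3) by (simp add: all_ports_append[of T xs w "[x]"])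
qed

lemma out_ports_step:
  assumes "u \<in> N" "adj w x" "path u x = path u w @ [x]"
  shows "out_ports T (path u x) = out_ports T (path u w) @ [port T w x]"
proof -
  have "w \<in> N" using adj_nodes assms by blast
  then obtain xs where "path u w = xs @ [w]"
    using path_props(3,4)[of u w] assms(1) by (metis append_butlast_last_id)
  then show ?thesis unfolding assms(3) by (simp add: out_ports_append[of T xs w "[x]"])
qed

lemma seq_self [simp]: "u \<in> N \<Longrightarrow> seq T u u = []"
  by (simp add: seq_def)

lemma seq_take:
  assumes "u \<in> N" "w \<in> N" "k \<le> d u w"
  shows "seq T u (path u w ! k) = take (2 * k) (seq T u w)"
  using node_at_dist(4)[OF assms] by (simp add: seq_def take_all_ports)

text \<open>One neighbour of \<open>z\<close> is its predecessor on the path from \<open>u\<close>;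
  any other neighbour prolongs the path. So a path is endless exactly because it can be continued
  beyond its last node.\<close>

lemma degree_eq_1:
  assumes "u \<in> N" "z \<in> N" "u \<noteq> z"
  shows "degree T z \<noteq> 1 \<longleftrightarrow> (\<exists>x. adj z x \<and> path u x = path u z @ [x])"
proof -
  obtain y where y: "adj y z" "path u z = path u y @ [z]" "y \<in> N" using path_last_step[OF assms] .
  have yn: "y \<in> nbrs T z" using y by (simp add: nbrs_def adj_commute)
  show ?thesis
  proof
    assume "degree T z \<noteq> 1"
    then have "nbrs T z \<noteq> {y}" by (auto simp: degree_def)
    then obtain x where x: "adj z x" "x \<noteq> y" using yn by (auto simp: nbrs_def)
    have "\<not> path u z = path u x @ [z]"
    proof
      assume "path u z = path u x @ [z]"
      then have "path u x = path u y" using y by simp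
      then show False using path_props(3)[OF assms(1)] x(2) y(3) adj_nodes[OF x(1)] by metis
    qed
    then show "\<exists>x. adj z x \<and> path u x = path u z @ [x]" using path_step[OF assms(1) x(1)] x by auto
  next
    assume "\<exists>x. adj z x \<and> path u x = path u z @ [x]"
    then obtain x where x: "adj z x" "path u x = path u z @ [x]" by auto
    then have "x \<noteq> y" using y by auto
    then have "{x, y} \<subseteq> nbrs T z" "card {x, y} = 2" using x yn by (auto simp: nbrs_def)
    then have "degree T z \<ge> 2" unfolding degree_def using card_mono[OF finite_nbrs] by metis
    then show "degree T z \<noteq> 1" by simp
  qed
qed

end

section \<open>The two sides of an edge; the diameter\<close>

context tree
begin

lemma dist_step: "u \<in> N \<Longrightarrow> w \<in> N \<Longrightarrow> path u x = path u w @ [x] \<Longrightarrow> d u x = Suc (d u w)"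
  using length_path[of u w] by (simp add: tdist_def[of T u x])

text \<open>The component of \<open>a\<close> after removal of the edge between \<open>a\<close> and
  \<open>b\<close>. Phrased through paths, the dichotomy of \<open>path_step\<close> directly
  becomes \<open>side_cases\<close>.\<close>

definition side :: "'a \<Rightarrow> 'a \<Rightarrow> 'a set" where
  "side a b = {w \<in> N. path w b = path w a @ [b]}"

lemma side_nodes: "w \<in> side a b \<Longrightarrow> w \<in> N"
  by (simp add: side_def)

lemma side_cases: "adj a b \<Longrightarrow> w \<in> N \<Longrightarrow> w \<in> side a b \<or> w \<in> side b a"
  using path_step[of w a b] by (auto simp: side_def)

lemma side_disjoint: "w \<in> side a b \<Longrightarrow> w \<notin> side b a"
  by (auto simp: side_def)

lemma side_self: "adj a b \<Longrightarrow> a \<in> side a b"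
  using adj_nodes[of a b] by (simp add: side_def path_adj)

lemma side_dist:
  assumes "adj a b" "w \<in> side a b" shows "d w b = Suc (d w a)"
  using assms adj_nodes[OF assms(1)] dist_step[of w a b] by (auto simp: side_def)

lemma side_on_path:
  assumes "adj a b" "w \<in> side a b" "y \<in> set (path w a)"
  shows "y \<in> side a b"
proof -
  have n: "a \<in> N" "b \<in> N" "w \<in> N" using adj_nodes assms side_nodes by blast+
  obtain xs ys where s: "path w a = xs @ y # ys" "path y a = y # ys"
    using path_split[OF n(3,1) assms(3)] .
  then have "path w b = xs @ y # (ys @ [b])" using assms(2) by (simp add: side_def)
  then have "path y b = y # ys @ [b]" using path_append(2)[OF n(3,2)] by blast
  moreover have "y \<in> N" using on_path_nodes n assms(3) by blast
  ultimately show ?thesis using s by (simp add: side_def)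
qed

lemma side_convex:
  assumes "adj a b" "u \<in> side a b" "w \<in> side a b"
  shows "set (path u w) \<subseteq> side a b"
proof -
  have n: "a \<in> N" "u \<in> N" "w \<in> N" using adj_nodes assms side_nodes by blast+
  have "set (path u w) \<subseteq> set (path a u) \<union> set (path a w)" using path_fork_subset n by blast
  then show ?thesis using side_on_path assms path_rev[of u a] path_rev[of w a] n by auto
qed

text \<open>Both halves stay on their own sides and are therefore disjoint, so joining them across
  the edge gives a simple path.\<close>

lemma cross:
  assumes "adj a b" "u \<in> side a b" "w \<in> side b a"
  shows "path u w = path u a @ path b w" "d u w = Suc (d u a + d b w)"
    "a \<in> set (path u w)" "b \<in> set (path u w)" "{a, b} \<in> path_edges (path u w)"
proof -
  have n: "a \<in> N" "b \<in> N" "u \<in> N" "w \<in> N" using adj_nodes assms side_nodes by blast+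
  note pu = path_props[OF n(3,1)] and pw = path_props[OF n(2,4)]
  have "adj b a" using assms adj_commute by blast
  then have "set (path u a) \<subseteq> side a b" "set (path b w) \<subseteq> side b a"
    using side_convex side_self assms by metis+
  then have "set (path u a) \<inter> set (path b w) = {}" using side_disjoint by blast
  then have "path_between T u w (path u a @ path b w)"
    using pu pw assms(1) by (auto simp: path_between_def simple_path_def successively_append_iff)
  then show *: "path u w = path u a @ path b w" by (rule path_eqI)
  then show "a \<in> set (path u w)" "b \<in> set (path u w)" using pu pw by auto
  show "d u w = Suc (d u a + d b w)"
    using * length_path[of u a] length_path[of b w] length_path[of u w] n by simp
  obtain xs where xs: "path u a = xs @ [a]" using pu by (metis append_butlast_last_id)
  obtain ys where ys: "path b w = b # ys" using pw by (metis list.collapse)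
  show "{a, b} \<in> path_edges (path u w)"
    by (simp add: * xs ys path_edges_append[of xs a "b # ys"] path_edges_Cons)
qed

lemma same_side_edge:
  assumes "adj a b" "u \<in> side a b" "w \<in> side a b"
  shows "{a, b} \<notin> path_edges (path u w)" "b \<notin> set (path u w)"
proof -
  have "b \<in> side b a" using side_self assms adj_commute by blast
  then show "b \<notin> set (path u w)" using side_convex[OF assms] side_disjoint by blast
  then show "{a, b} \<notin> path_edges (path u w)" using path_edges_subset by blast
qed

lemma edge_on_path_iff:
  assumes "adj a b" "u \<in> side a b" "w \<in> N"
  shows "{a, b} \<in> path_edges (path u w) \<longleftrightarrow> w \<in> side b a"
  using side_cases[OF assms(1,3)] side_disjoint cross(5)[OF assms(1,2)] same_side_edge(1)[OF assms(1,2)] by blast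

lemma adj_across:
  assumes "adj a b" "adj u w" "u \<in> side a b" "w \<in> side b a"
  shows "u = a" "w = b"
proof -
  have n: "a \<in> N" "b \<in> N" "u \<in> N" "w \<in> N" using adj_nodes assms side_nodes by blast+
  have "d u w = 1" using path_adj[OF assms(2)] by (simp add: tdist_def)
  then have "d u a = 0" "d b w = 0" using cross(2)[OF assms(1,3,4)] by auto
  then show "u = a" "w = b" using dist_eq_0 n by auto
qed

lemma dist_le_diameter: "u \<in> N \<Longrightarrow> w \<in> N \<Longrightarrow> d u w \<le> diameter T"
proof -
  assume "u \<in> N" "w \<in> N"
  have "{d u w |u w. u \<in> N \<and> w \<in> N} = (\<lambda>(u, w). d u w) ` (N \<times> N)" by auto
  then have "finite {d u w |u w. u \<in> N \<and> w \<in> N}" using finite_nodes by simp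
  then show ?thesis unfolding diameter_def using \<open>u \<in> N\<close> \<open>w \<in> N\<close> by (intro Max_ge) auto
qed

lemma diameter_attained: obtains u w where "u \<in> N" "w \<in> N" "d u w = diameter T"
proof -
  have "{d u w |u w. u \<in> N \<and> w \<in> N} = (\<lambda>(u, w). d u w) ` (N \<times> N)" by auto
  then have "finite {d u w |u w. u \<in> N \<and> w \<in> N}" "{d u w |u w. u \<in> N \<and> w \<in> N} \<noteq> {}"
    using finite_nodes nodes_ne by auto
  from Max_in[OF this] show ?thesis using that unfolding diameter_def by auto
qed

lemma diameter_less: "diameter T < card N"
proof -
  obtain u w where uw: "u \<in> N" "w \<in> N" "d u w = diameter T" by (rule diameter_attained)
  have "length (path u w) = card (set (path u w))" using path_props(8)[OF uw(1,2)] by (simp add: distinct_card)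
  also have "\<dots> \<le> card N" using path_props(7)[OF uw(1,2)] finite_nodes by (rule card_mono[rotated])
  finally show ?thesis using length_path[OF uw(1,2)] uw(3) by simp
qed

end

section \<open>The central edge\<close>

text \<open>The assumptions are invariant under exchanging the two ends, so every lemma also holds,
  by \<open>swap\<close>, for the other side. \<open>middle\<close> serves only to evaluate the
  definite description in \<open>central_edge\<close>.\<close>

locale central_tree = tree +
  fixes a b :: 'a and h :: nat
  assumes adj_ab: "adj a b"
    and diam: "diameter T = Suc (2 * h)"
    and h_pos: "h > 0"
    and depth_a: "\<And>w. w \<in> side a b \<Longrightarrow> d w a \<le> h"
    and depth_b: "\<And>w. w \<in> side b a \<Longrightarrow> d w b \<le> h"
    and deep_a: "\<exists>w \<in> side a b. d w a = h"
    and deep_b: "\<exists>w \<in> side b a. d w b = h"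
    and middle: "\<And>xs. simple_path T xs \<Longrightarrow> length xs = Suc (diameter T) \<Longrightarrow> {a, b} = {xs ! h, xs ! Suc h}"

lemma (in central_tree) swap: "central_tree T b a h"
  using adj_ab diam h_pos depth_a depth_b deep_a deep_b middle
  by unfold_locales (auto simp: insert_commute)

text \<open>The edge is the middle edge of one longest path. A node deeper than \<open>h\<close>,
  joined to the end of this path on the opposite side, would exceed the diameter. The ends of any
  other longest path cannot share a side, where distances are at most \<open>2 * h\<close>; so they
  lie opposite each other at depth \<open>h\<close>, and the path has the same middle edge.\<close>

lemma (in tree) central_tree_exists:
  assumes "odd (diameter T)" "diameter T > 1"
  shows "\<exists>a b h. central_tree T a b h"
proof -
  define h where "h = (diameter T - 1) div 2"
  have D: "diameter T = Suc (2 * h)" and h: "h > 0" using assms by (auto simp: h_def elim!: oddE)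
  obtain u w where uw: "u \<in> N" "w \<in> N" "d u w = diameter T" by (rule diameter_attained)
  note p = path_props[OF uw(1,2)]
  have len: "length (path u w) = Suc (Suc (2 * h))" using length_path uw D by simp
  define a where "a = path u w ! h"
  define b where "b = path u w ! Suc h"
  have na: "a \<in> N" "a \<in> set (path u w)" "d u a = h" "path u a = take (Suc h) (path u w)"
    using node_at_dist[OF uw(1,2), of h] uw(3) D by (auto simp: a_def)
  have nb: "b \<in> N" "b \<in> set (path u w)" "d u b = Suc h" "path u b = take (Suc (Suc h)) (path u w)"
    using node_at_dist[OF uw(1,2), of "Suc h"] uw(3) D by (auto simp: b_def)
  have ub: "path u b = path u a @ [b]" using na nb len by (simp add: b_def take_Suc_conv_app_nth)
  have adj: "adj a b" using p(1) len successively_nth[of adj "path u w" h]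
    by (simp add: simple_path_def a_def b_def successively_conv_nth)
  have ua: "u \<in> side a b" using ub uw by (simp add: side_def)
  have adj': "adj b a" using adj adj_commute by blast
  have dw: "d b w = h" using dist_on_path[OF uw(1,2) nb(2)] uw(3) nb(3) D by simp
  have dw': "d a w = Suc h" using dist_on_path[OF uw(1,2) na(2)] uw(3) na(3) D by simp
  have wb: "w \<in> side b a"
  proof (rule ccontr)
    assume "w \<notin> side b a"
    then have "w \<in> side a b" using side_cases adj uw by blast
    then have "d w b = Suc (d w a)" by (rule side_dist[OF adj])
    then show False using dw dw' dist_commute[OF uw(2) na(1)] dist_commute[OF uw(2) nb(1)] by simp
  qed
  have A: "d x a \<le> h" if "x \<in> side a b" for x
    using cross(2)[OF adj that wb] dist_le_diameter[of x w] side_nodes[OF that] uw dw D by simp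
  have B: "d x b \<le> h" if "x \<in> side b a" for x
    using cross(2)[OF adj ua that] dist_le_diameter[of u x] side_nodes[OF that] uw na nb dist_commute[of x b] D by simp
  have hD: "(diameter T - 1) div 2 = h" by (simp add: h_def)
  have mid: "{a, b} = {xs ! h, xs ! Suc h}" if xs: "simple_path T xs" "length xs = Suc (diameter T)" for xs
  proof -
    define x y where "x = hd xs" and "y = last xs"
    have xy: "path x y = xs" "x \<in> N" "y \<in> N"
      using simple_path_eq xs by (auto simp: x_def y_def simple_path_def)
    have dxy: "d x y = Suc (2 * h)" using xs xy D by (simp add: tdist_def)
    have *: "{c, e} = {xs ! h, xs ! Suc h}" if "adj c e" "x \<in> side c e" "y \<in> side e c" "d x c \<le> h" "d y e \<le> h" for c e
    proof -
      have n: "c \<in> N" "e \<in> N" using that(1) adj_nodes by blast+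
      have "d x c = h" "d e y = h" using cross(2)[OF that(1-3)] dxy that(4,5) dist_commute[of y e] xy n by auto
      moreover have "c \<in> set xs" "e \<in> set xs" using cross(3,4)[OF that(1-3)] xy by auto
      ultimately show ?thesis using path_nth[of x y c] path_nth[of x y e] xy side_dist[OF that(1,2)] by auto
    qed
    have no: False if "adj c e" "x \<in> side c e" "y \<in> side c e" "d x c \<le> h" "d y c \<le> h" for c e
      using dist_triangle[of x c y] xy adj_nodes[OF that(1)] dxy that dist_commute[of y c] by simp
    show ?thesis
      using side_cases[OF adj xy(2)] side_cases[OF adj xy(3)] *[of a b] *[of b a] no[of a b] no[of b a] A B adj adj'
      by (metis insert_commute)
  qed
  have "\<exists>w \<in> side a b. d w a = h" using ua na by blast
  moreover have "\<exists>w \<in> side b a. d w b = h" using wb dw dist_commute[of w b] uw nb by auto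
  ultimately have "central_tree T a b h"
    using adj D h A B mid by unfold_locales auto
  then show ?thesis by blast
qed

section \<open>Endless paths of length \<open>D - 2\<close> and their gateways\<close>

context central_tree
begin

text \<open>The last nodes of the endless paths from \<open>v\<close>, since
  \<open>D - 2 = 2 * h - 1\<close>; in a tree these nodes determine the paths.\<close>

definition ends :: "'a \<Rightarrow> 'a set" where
  "ends v = {z \<in> N. d v z = 2 * h - 1 \<and> degree T z \<noteq> 1}"

lemma ab_nodes: "a \<in> N" "b \<in> N"
  using adj_nodes[OF adj_ab] by auto

lemma adj_ba: "adj b a"
  using adj_ab adj_commute by blast

lemma sides: "w \<in> N \<Longrightarrow> w \<in> side a b \<or> w \<in> side b a"
  using side_cases[OF adj_ab] .

lemma diam_simps: "diameter T - 2 = 2 * h - 1" "(diameter T - 1) div 2 = h"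
  using diam by auto

lemma diameter_path: obtains xs where "simple_path T xs" "length xs = Suc (diameter T)"
  using diameter_attained path_props(1) length_path by metis

lemma central: "central_edge T = {a, b}"
  unfolding central_edge_def diam_simps
proof (rule the_equality)
  show "\<forall>xs. simple_path T xs \<and> length xs = Suc (diameter T) \<longrightarrow> {a, b} = {xs ! h, xs ! Suc h}"
    using middle by blast
  fix e assume *: "\<forall>xs. simple_path T xs \<and> length xs = Suc (diameter T) \<longrightarrow> e = {xs ! h, xs ! Suc h}"
  obtain xs where "simple_path T xs" "length xs = Suc (diameter T)" by (rule diameter_path)
  then show "e = {a, b}" using * middle by metis
qed

text \<open>A further neighbour would be at distance \<open>h + 2\<close> from \<open>a\<close>, but
  nodes on the side of \<open>a\<close> are within \<open>h\<close> and those across within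
  \<open>h + 1\<close>.\<close>

lemma deep_leaf:
  assumes "z \<in> side b a" "d b z = h"
  shows "degree T z = 1"
proof (rule ccontr)
  assume "degree T z \<noteq> 1"
  have z: "z \<in> N" "a \<noteq> z" using assms side_nodes side_disjoint side_self[OF adj_ab] by blast+
  obtain x where x: "adj z x" "path a x = path a z @ [x]"
    using degree_eq_1[OF ab_nodes(1) z] \<open>degree T z \<noteq> 1\<close> by blast
  have "x \<in> N" using adj_nodes x by blast
  have "d a z = Suc h" using cross(2)[OF adj_ab side_self[OF adj_ab] assms(1)] assms(2) ab_nodes by simp
  then have "d a x = Suc (Suc h)" using dist_step[OF ab_nodes(1) z(1) x(2)] by simp
  then show False
    using sides[OF \<open>x \<in> N\<close>] depth_a[of x] depth_b[of x] side_dist[OF adj_ba, of x] dist_commute[of a x] \<open>x \<in> N\<close> ab_nodes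
    by auto
qed

text \<open>If \<open>z\<close> is across, it is not a leaf and so has depth at most
  \<open>h - 1\<close>; the length \<open>2 * h - 1\<close> then leaves at least
  \<open>h - 1\<close> for the distance from \<open>v\<close> to \<open>a\<close>. If
  \<open>z\<close> is on the side of \<open>v\<close>, the path is prolonged to a node
  \<open>x\<close> at distance \<open>2 * h\<close>; when \<open>x\<close> is still on this side,
  both ends must have depth \<open>h\<close> and the path must pass through
  \<open>a\<close>.\<close>

lemma endless_end:
  assumes v: "v \<in> side a b" and z: "z \<in> ends v"
  shows "a \<in> set (path v z)" and "d v a = h \<or> Suc (d v a) = h \<and> z \<in> side b a"
proof -
  have n: "v \<in> N" "z \<in> N" "d v z = 2 * h - 1" "degree T z \<noteq> 1"
    using v z side_nodes by (auto simp: ends_def)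
  have va: "d v a \<le> h" using depth_a v by blast
  have "a \<in> set (path v z) \<and> (d v a = h \<or> Suc (d v a) = h \<and> z \<in> side b a)"
  proof (cases "z \<in> side b a")
    case True
    have "d b z \<le> h" using depth_b[OF True] dist_commute ab_nodes n by simp
    moreover have "d b z \<noteq> h" using deep_leaf[OF True] n by blast
    ultimately show ?thesis using cross(2,3)[OF adj_ab v True] n(3) True va h_pos by auto
  next
    case False
    then have za: "z \<in> side a b" using sides n by blast
    have "v \<noteq> z" using n(1,3) h_pos by auto
    then obtain x where x: "adj z x" "path v x = path v z @ [x]" using degree_eq_1[OF n(1,2)] n(4) by blast
    have xn: "x \<in> N" using adj_nodes x by blast
    have dvx: "d v x = 2 * h" using dist_step[OF n(1,2) x(2)] n(3) h_pos by simp
    show ?thesis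
    proof (cases "x \<in> side a b")
      case True
      have "d a x \<le> h" using depth_a[OF True] dist_commute ab_nodes xn by simp
      then have *: "d v a = h" "d a x = h" using dist_triangle[OF n(1) ab_nodes(1) xn] dvx va by auto
      then have "a \<in> set (path v x)" using on_path_iff[OF n(1) ab_nodes(1) xn] dvx by simp
      moreover have "a \<noteq> x" using *(2) h_pos ab_nodes by auto
      ultimately show ?thesis using x(2) * by simp
    next
      case False
      \<comment> \<open>The prolongation crosses the central edge. Then \<open>2 * h - 1\<close> is
        the distance from \<open>v\<close> to \<open>a\<close>, which is at most \<open>h\<close>;
        so \<open>h = 1\<close> and \<open>v\<close> has depth \<open>h\<close>.\<close>
      then have "z = a" using adj_across(1)[OF adj_ab x(1) za] sides xn by blast
      then show ?thesis using n va path_props(6)[OF n(1,2)] h_pos by auto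
    qed
  qed
  then show "a \<in> set (path v z)" and "d v a = h \<or> Suc (d v a) = h \<and> z \<in> side b a" by auto
qed

text \<open>A path that goes further than \<open>2 * h - 1\<close> has an inner node at that
  distance, hence no leaf. So without endless paths the view is the whole tree.\<close>

lemma far_end:
  assumes "v \<in> N" "w \<in> N" "d v w > 2 * h - 1"
  shows "path v w ! (2 * h - 1) \<in> ends v"
proof -
  define z where "z = path v w ! (2 * h - 1)"
  define x where "x = path v w ! (2 * h)"
  have z: "z \<in> N" "d v z = 2 * h - 1" "path v z = take (2 * h) (path v w)"
    using node_at_dist[OF assms(1,2), of "2 * h - 1"] assms(3) h_pos by (auto simp: z_def)
  have "Suc (2 * h - 1) = 2 * h" using h_pos by simp
  have x: "x \<in> N" "path v x = take (Suc (2 * h)) (path v w)"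
    using node_at_dist[OF assms(1,2), of "2 * h"] assms(3) by (auto simp: x_def)
  have lt: "2 * h < length (path v w)" using assms length_path[of v w] by simp
  then have "path v x = path v z @ [x]" using x(2) z(3) by (simp add: take_Suc_conv_app_nth x_def)
  moreover have "adj z x"
    using path_props(1)[OF assms(1,2)] lt h_pos successively_nth[of adj "path v w" "2 * h - 1"]
    by (simp add: simple_path_def z_def x_def)
  moreover have "v \<noteq> z" using z(1,2) h_pos by auto
  ultimately have "degree T z \<noteq> 1" using degree_eq_1[OF assms(1) z(1)] by blast
  then show ?thesis using z by (simp add: ends_def z_def)
qed

text \<open>The nodes competing for the gateway, described in the tree instead of a view. Without
  endless paths this is the whole ball around \<open>v\<close>.\<close>

definition common :: "'a \<Rightarrow> 'a set" where
  "common v = {w \<in> N. d v w \<le> 2 * h - 1 \<and> (\<forall>z\<in>ends v. w \<in> set (path v z))}"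

lemma gateway_on:
  assumes v: "v \<in> N" and z: "z \<in> ends v" and g: "is_arg_max (d v) (\<lambda>w. w \<in> common v) g"
    and c: "c \<in> common v"
  shows "g \<in> N" "g \<in> set (path v z)" "c \<in> set (path v g)"
proof -
  have g': "g \<in> common v" "d v c \<le> d v g" using g c by (auto simp: is_arg_max_linorder)
  show "g \<in> N" "g \<in> set (path v z)" using g' z by (auto simp: common_def)
  moreover have "c \<in> set (path v z)" "z \<in> N" using c z by (auto simp: common_def ends_def)
  ultimately show "c \<in> set (path v g)" using on_path_le[OF v] g' by blast
qed

lemma gateway_ex:
  assumes v: "v \<in> N"
  shows "\<exists>g. is_arg_max (d v) (\<lambda>w. w \<in> common v) g"
proof -
  have "v \<in> common v" using v path_props(5) by (auto simp: common_def ends_def)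
  moreover have "finite (common v)" using finite_nodes by (simp add: common_def)
  ultimately have "finite (d v ` common v)" "d v ` common v \<noteq> {}" by auto
  from Max_in[OF this] obtain g where "g \<in> common v" "d v g = Max (d v ` common v)" by auto
  moreover have "d v x \<le> Max (d v ` common v)" if "x \<in> common v" for x
    using \<open>finite (d v ` common v)\<close> that by (intro Max_ge) auto
  ultimately show ?thesis by (auto simp: is_arg_max_linorder)
qed

text \<open>All candidates lie on the one path to \<open>z\<close>, where the distance from
  \<open>v\<close> identifies a node.\<close>

lemma gateway_unique:
  assumes v: "v \<in> N" and z: "z \<in> ends v"
  shows "\<exists>!g. is_arg_max (d v) (\<lambda>w. w \<in> common v) g"
proof -
  obtain g where g: "is_arg_max (d v) (\<lambda>w. w \<in> common v) g" using gateway_ex[OF v] by blast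
  have "g' = g" if g': "is_arg_max (d v) (\<lambda>w. w \<in> common v) g'" for g'
  proof -
    have "d v g' = d v g" using g g' by (simp add: is_arg_max_linorder order_antisym)
    moreover have "g \<in> set (path v z)" "g' \<in> set (path v z)" "z \<in> N"
      using g g' z by (auto simp: is_arg_max_linorder common_def ends_def)
    ultimately show ?thesis using on_path_eq[OF v] by metis
  qed
  then show ?thesis using g by blast
qed

lemma common_across:
  assumes v: "v \<in> side a b" and z: "z \<in> ends v" and across: "\<And>z. z \<in> ends v \<Longrightarrow> z \<in> side b a"
  shows "b \<in> common v"
proof -
  have b: "b \<in> set (path v z)" if "z \<in> ends v" for z using cross(4)[OF adj_ab v across[OF that]] .
  have "d v z = d v b + d b z" using dist_on_path[of v z b] b[OF z] z v side_nodes by (auto simp: ends_def)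
  then show ?thesis using b z ab_nodes by (auto simp: common_def ends_def)
qed

text \<open>If all endless paths cross, \<open>b\<close> is common to them and the gateway is at or
  beyond \<open>b\<close>. If there are none, the gateway is a node furthest from \<open>v\<close>
  in the whole tree: on the own side distances are at most \<open>d v a + h\<close>, whereas a
  deepest node across is one step further.\<close>

lemma gateway_side:
  assumes v: "v \<in> side a b" and g: "is_arg_max (d v) (\<lambda>w. w \<in> common v) g"
    and across: "\<And>z. z \<in> ends v \<Longrightarrow> z \<in> side b a"
  shows "g \<in> side b a"
proof (cases "ends v = {}")
  case True
  have vn: "v \<in> N" using v side_nodes by blast
  have cv: "common v = N"
    using far_end[OF vn] True by (force simp: common_def)
  obtain w where w: "w \<in> side b a" "d w b = h" using deep_b by blast
  have wn: "w \<in> N" using w side_nodes by blast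
  then have gn: "g \<in> N" "d v w \<le> d v g" using g cv by (auto simp: is_arg_max_linorder)
  have "d v w = Suc (d v a + h)" using cross(2)[OF adj_ab v w(1)] w(2) dist_commute[of w b] wn ab_nodes by simp
  moreover have "d v g \<le> d v a + d g a" using dist_triangle[OF vn ab_nodes(1) gn(1)] dist_commute gn ab_nodes by simp
  ultimately show ?thesis using sides[OF gn(1)] depth_a[of g] gn by fastforce
next
  case False
  then obtain z where z: "z \<in> ends v" by blast
  have b: "b \<in> common v" using common_across[OF v z] across by blast
  have vn: "v \<in> N" using v side_nodes by blast
  have "g \<in> N" "b \<in> set (path v g)" using gateway_on[OF vn z g b] by auto
  then show ?thesis using sides same_side_edge(2)[OF adj_ab v] by blast
qed

end

section \<open>Views\<close>

lemma the_image:
  assumes "\<exists>!x. P x" "\<And>y. Q y \<longleftrightarrow> (\<exists>x. y = f x \<and> P x)"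
  shows "(THE y. Q y) = f (THE x. P x)"
proof -
  obtain x where x: "P x" "\<And>y. P y \<Longrightarrow> y = x" using assms(1) by blast
  then have "(THE x. P x) = x" by (rule the_equality)
  moreover have "(THE y. Q y) = f x" using x assms(2) by (intro the_equality) blast+
  ultimately show ?thesis by simp
qed

text \<open>\<open>V\<close> is a copy of the ball around \<open>v\<close> under a renaming
  \<open>f\<close> that is injective there. With \<open>f = id\<close> this covers
  \<open>local_view\<close>, with outgoing port sequences the anonymised \<open>view\<close>, so one
  set of transfer lemmas serves both.\<close>

locale ball_view = tree +
  fixes v :: 'a and r :: nat and V :: "'b pview" and f :: "'a \<Rightarrow> 'b"
  assumes root_node: "v \<in> N"
    and nodes_V: "nodes V = f ` {w \<in> N. d v w \<le> r}"
    and inj: "inj_on f {w \<in> N. d v w \<le> r}"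
    and edges_V: "\<And>x y. x \<in> N \<Longrightarrow> y \<in> N \<Longrightarrow> d v x \<le> r \<Longrightarrow> d v y \<le> r \<Longrightarrow> {f x, f y} \<in> edges V \<longleftrightarrow> adj x y"
    and port_V: "\<And>x y. adj x y \<Longrightarrow> d v x \<le> r \<Longrightarrow> d v y \<le> r \<Longrightarrow> port V (f x) (f y) = port T x y"
    and root_V: "vroot V = f v"
    and degree_V: "\<And>x. x \<in> N \<Longrightarrow> d v x \<le> r \<Longrightarrow> vdeg V (f x) = degree T x"
begin

definition B where "B = {w \<in> N. d v w \<le> r}"

lemma B_nodes: "x \<in> B \<Longrightarrow> x \<in> N"
  by (simp add: B_def)

lemma root_B: "v \<in> B"
  using root_node by (simp add: B_def)

lemma path_B: "x \<in> B \<Longrightarrow> y \<in> B \<Longrightarrow> set (path x y) \<subseteq> B"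
  unfolding B_def using ball_convex[OF root_node, of x y] on_path_nodes[of x y] by blast

lemma f_eq_iff: "x \<in> B \<Longrightarrow> y \<in> B \<Longrightarrow> f x = f y \<longleftrightarrow> x = y"
  using inj by (auto simp: B_def inj_on_def)

lemma inj_B: "inj_on f B"
  using inj by (simp add: B_def)

lemma successively_V:
  "set xs \<subseteq> B \<Longrightarrow> successively (\<lambda>u w. {u, w} \<in> edges V) (map f xs) \<longleftrightarrow> successively adj xs"
  by (induction xs rule: induct_list012) (auto simp: B_def edges_V)

lemma simple_path_V: "simple_path V ys \<longleftrightarrow> (\<exists>xs. ys = map f xs \<and> simple_path T xs \<and> set xs \<subseteq> B)"
proof
  assume ys: "simple_path V ys"
  then have "ys \<in> lists (f ` B)" by (auto simp: simple_path_def nodes_V B_def)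
  then obtain xs where xs: "ys = map f xs" "set xs \<subseteq> B" unfolding lists_image by auto
  then have "simple_path T xs"
    using ys successively_V[OF xs(2)] B_nodes by (auto simp: simple_path_def distinct_map)
  then show "\<exists>xs. ys = map f xs \<and> simple_path T xs \<and> set xs \<subseteq> B" using xs by blast
next
  assume "\<exists>xs. ys = map f xs \<and> simple_path T xs \<and> set xs \<subseteq> B"
  then obtain xs where xs: "ys = map f xs" "simple_path T xs" "set xs \<subseteq> B" by blast
  then show "simple_path V ys"
    using successively_V[OF xs(3)] inj_on_subset[OF inj_B xs(3)]
    by (auto simp: simple_path_def distinct_map nodes_V B_def)
qed

lemma path_between_V:
  assumes "x \<in> B" "y \<in> B"
  shows "path_between V (f x) (f y) ys \<longleftrightarrow> ys = map f (path x y)"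
proof
  assume "path_between V (f x) (f y) ys"
  then obtain xs where xs: "ys = map f xs" "simple_path T xs" "set xs \<subseteq> B" "hd ys = f x" "last ys = f y"
    by (auto simp: path_between_def simple_path_V)
  then have "xs \<noteq> []" by (auto simp: simple_path_def)
  then have "hd xs \<in> B" "last xs \<in> B" "f (hd xs) = f x" "f (last xs) = f y"
    using xs by (auto simp: hd_map last_map)
  then have "hd xs = x" "last xs = y" using assms f_eq_iff by blast+
  then show "ys = map f (path x y)" using simple_path_eq[OF xs(2)] xs(1) by simp
next
  assume ys: "ys = map f (path x y)"
  have "x \<in> N" "y \<in> N" using assms B_nodes by auto
  note p = path_props[OF this]
  have "simple_path V ys" using ys p(1) path_B[OF assms] simple_path_V by blast
  then show "path_between V (f x) (f y) ys"
    using ys p by (simp add: path_between_def hd_map last_map)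
qed

lemma tpath_V: "x \<in> B \<Longrightarrow> y \<in> B \<Longrightarrow> tpath V (f x) (f y) = map f (path x y)"
  unfolding tpath_def[of V] by (rule the_equality) (simp_all add: path_between_V)

lemma tdist_V: "x \<in> B \<Longrightarrow> y \<in> B \<Longrightarrow> tdist V (f x) (f y) = d x y"
  by (simp add: tdist_def tpath_V)

lemma all_ports_V:
  "successively adj xs \<Longrightarrow> set xs \<subseteq> B \<Longrightarrow> all_ports V (map f xs) = all_ports T xs"
  by (induction xs rule: induct_list012) (auto simp: B_def port_V adj_commute)

lemma seq_V: "x \<in> B \<Longrightarrow> y \<in> B \<Longrightarrow> seq V (f x) (f y) = seq T x y"
  using path_props(1)[of x y] path_B[of x y] B_nodes
  by (simp add: seq_def tpath_V all_ports_V simple_path_def)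

lemma out_ports_V: "x \<in> B \<Longrightarrow> y \<in> B \<Longrightarrow> out_ports V (tpath V (f x) (f y)) = out_ports T (path x y)"
  using seq_V[of x y] by (simp add: seq_def out_ports_conv)

lemma image_pair_in_path_edges:
  assumes "x \<in> B" "y \<in> B" "set xs \<subseteq> B"
  shows "{f x, f y} \<in> path_edges (map f xs) \<longleftrightarrow> {x, y} \<in> path_edges xs"
proof
  assume "{f x, f y} \<in> path_edges (map f xs)"
  then obtain e where e: "e \<in> path_edges xs" "f ` {x, y} = f ` e" by (auto simp: path_edges_map)
  then have "e \<subseteq> B" using path_edges_subset assms by blast
  then have "{x, y} = e" using inj_on_image_eq_iff[OF inj_B, of "{x, y}" e] e assms by simp
  then show "{x, y} \<in> path_edges xs" using e by simp
next
  assume "{x, y} \<in> path_edges xs"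
  then have "f ` {x, y} \<in> path_edges (map f xs)" unfolding path_edges_map by (rule imageI)
  then show "{f x, f y} \<in> path_edges (map f xs)" by simp
qed

lemma endless_V:
  "endless r V ys \<longleftrightarrow> (\<exists>z\<in>N. d v z = r \<and> degree T z \<noteq> 1 \<and> ys = map f (path v z))"
proof
  assume "endless r V ys"
  then obtain xs where xs: "ys = map f xs" "simple_path T xs" "set xs \<subseteq> B" "hd ys = f v"
    "length xs = Suc r" "vdeg V (last ys) \<noteq> 1"
    by (auto simp: endless_def simple_path_V root_V)
  have "xs \<noteq> []" using xs by auto
  then have z: "hd xs \<in> B" "f (hd xs) = f v" "last xs \<in> B" "last ys = f (last xs)"
    using xs by (auto simp: hd_map last_map)
  then have "hd xs = v" using f_eq_iff root_B by blast
  then have "path v (last xs) = xs" using simple_path_eq[OF xs(2)] by simp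
  then have "d v (last xs) = r" using xs(5) by (simp add: tdist_def)
  moreover have "degree T (last xs) \<noteq> 1" using z xs(6) degree_V by (simp add: B_def)
  ultimately show "\<exists>z\<in>N. d v z = r \<and> degree T z \<noteq> 1 \<and> ys = map f (path v z)"
    using \<open>path v (last xs) = xs\<close> xs(1) z B_nodes by metis
next
  assume "\<exists>z\<in>N. d v z = r \<and> degree T z \<noteq> 1 \<and> ys = map f (path v z)"
  then obtain z where z: "z \<in> N" "d v z = r" "degree T z \<noteq> 1" "ys = map f (path v z)" by blast
  have zB: "z \<in> B" using z by (simp add: B_def)
  have "path_between V (f v) (f z) ys" using path_between_V root_B zB z by blast
  then show "endless r V ys"
    using z zB length_path[OF root_node z(1)] degree_V
    by (simp add: endless_def path_between_def root_V)
qed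

lemma gateway_V:
  "gateway r V y \<longleftrightarrow> (\<exists>g. y = f g \<and> is_arg_max (d v)
     (\<lambda>w. w \<in> N \<and> d v w \<le> r \<and> (\<forall>z\<in>{z\<in>N. d v z = r \<and> degree T z \<noteq> 1}. w \<in> set (path v z))) g)"
proof -
  define C where "C = {w \<in> B. \<forall>z\<in>N. d v z = r \<and> degree T z \<noteq> 1 \<longrightarrow> w \<in> set (path v z)}"
  have "(f w \<in> nodes V \<and> (\<forall>xs. endless r V xs \<longrightarrow> f w \<in> set xs)) \<longleftrightarrow> w \<in> C" if w: "w \<in> B" for w
  proof -
    have "f w \<in> set (map f (path v z)) \<longleftrightarrow> w \<in> set (path v z)" if "z \<in> N" "d v z = r" for z
    proof -
      have "z \<in> B" using that by (simp add: B_def)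
      then show ?thesis using inj_on_image_mem_iff[OF inj_B w path_B[OF root_B]] by simp
    qed
    then show ?thesis using w by (auto simp: C_def endless_V nodes_V B_def)
  qed
  moreover have "y \<in> nodes V \<longleftrightarrow> (\<exists>w\<in>B. y = f w)" for y by (auto simp: nodes_V B_def)
  ultimately have CV: "(y \<in> nodes V \<and> (\<forall>xs. endless r V xs \<longrightarrow> y \<in> set xs)) \<longleftrightarrow> (\<exists>w\<in>C. y = f w)" for y
    by (auto simp: C_def)
  have dC: "tdist V (f v) (f w) = d v w" if "w \<in> C" for w
    using that tdist_V root_B by (simp add: C_def)
  have "gateway r V y \<longleftrightarrow> (\<exists>w\<in>C. y = f w) \<and>
      (\<forall>y'. (\<exists>w\<in>C. y' = f w) \<longrightarrow> tdist V (f v) y' \<le> tdist V (f v) y)"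
    by (simp add: gateway_def is_arg_max_linorder CV root_V)
  also have "\<dots> \<longleftrightarrow> (\<exists>g\<in>C. y = f g \<and> (\<forall>w\<in>C. tdist V (f v) (f w) \<le> tdist V (f v) (f g)))"
    by blast
  also have "\<dots> \<longleftrightarrow> (\<exists>g. y = f g \<and> g \<in> C \<and> (\<forall>w\<in>C. d v w \<le> d v g))"
    using dC by auto
  finally show ?thesis unfolding is_arg_max_linorder C_def B_def by blast
qed

end

context tree
begin

lemma ball_view_local:
  assumes "v \<in> N"
  shows "ball_view T v r (local_view T v r) id"
  using assms by unfold_locales (auto simp: local_view_def Let_def)

lemma ball_view_view:
  assumes "v \<in> N"
  shows "ball_view T v r (view T v r) (\<lambda>w. out_ports T (path v w))"
proof -
  interpret L: ball_view T v r "local_view T v r" id by (rule ball_view_local[OF assms])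
  define f where "f = (\<lambda>w. out_ports T (path v w))"
  \<comment> \<open>\<open>f0\<close> is the renaming as \<open>anon\<close> computes it, from paths
    inside the local view; \<open>f\<close> computes it in the tree. They agree on the ball, because
    it contains the paths from its centre.\<close>
  define f0 where "f0 = (\<lambda>w. out_ports (local_view T v r) (tpath (local_view T v r) (vroot (local_view T v r)) w))"
  have f0: "f0 w = f w" if "w \<in> L.B" for w
    using L.out_ports_V[OF L.root_B that] L.root_V by (simp add: f0_def f_def)
  have nodes: "nodes (local_view T v r) = L.B" using L.nodes_V by (simp add: L.B_def)
  have lv: "port (local_view T v r) = port T" "vroot (local_view T v r) = v"
    "vdeg (local_view T v r) = degree T"
    by (simp_all add: local_view_def Let_def)
  have inj: "inj_on f L.B"
    using out_ports_inj[OF assms] L.B_nodes by (auto simp: inj_on_def f_def)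
  then have inj0: "inj_on f0 L.B" using f0 by (simp add: inj_on_def)
  define g where "g = inv_into L.B f0"
  have g: "g (f w) = w" if "w \<in> L.B" for w
    using inv_into_f_f[OF inj0 that] f0[OF that] by (simp add: g_def)
  have E: "{f x, f y} \<in> (\<lambda>e. f0 ` e) ` edges (local_view T v r) \<longleftrightarrow> adj x y" if xy: "x \<in> L.B" "y \<in> L.B" for x y
  proof
    assume "{f x, f y} \<in> (\<lambda>e. f0 ` e) ` edges (local_view T v r)"
    then obtain e where e: "e \<in> edges T" "e \<subseteq> L.B" "{f x, f y} = f0 ` e"
      by (auto simp: local_view_def Let_def L.B_def)
    then have "f0 ` {x, y} = f0 ` e" using f0 xy by simp
    then have "{x, y} = e" using inj_on_image_eq_iff[OF inj0, of "{x, y}" e] e(2) xy by simp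
    then show "adj x y" using e by simp
  next
    assume "adj x y"
    then have "{x, y} \<in> edges (local_view T v r)"
      using xy by (auto simp: local_view_def Let_def L.B_def)
    moreover have "{f x, f y} = f0 ` {x, y}" using f0 xy by simp
    ultimately show "{f x, f y} \<in> (\<lambda>e. f0 ` e) ` edges (local_view T v r)" by (metis imageI)
  qed
  have V: "view T v r = \<lparr>nodes = f0 ` L.B, edges = (\<lambda>e. f0 ` e) ` edges (local_view T v r),
     port = (\<lambda>x y. if {x, y} \<in> (\<lambda>e. f0 ` e) ` edges (local_view T v r) then port T (g x) (g y) else 0),
     vroot = f0 v, vdeg = (\<lambda>x. if x \<in> f0 ` L.B then degree T (g x) else 0)\<rparr>"
    unfolding view_def anon_def Let_def f0_def nodes g_def lv ..
  have "f0 ` L.B = f ` L.B" using f0 by simp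
  then have "ball_view T v r (view T v r) f"
    unfolding V using assms inj E g f0 L.root_B adj_nodes
    by unfold_locales (auto simp: L.B_def)
  then show ?thesis by (simp add: f_def)
qed

end

section \<open>Correctness of the algorithm\<close>

context tree
begin

lemma path_next:
  assumes "u \<in> N" "w \<in> N" "k < d u w"
  shows "adj (path u w ! k) (path u w ! Suc k)"
    "path u (path u w ! Suc k) = path u (path u w ! k) @ [path u w ! Suc k]"
proof -
  have lt: "Suc k < length (path u w)" using assms length_path by simp
  then show "adj (path u w ! k) (path u w ! Suc k)"
    using path_props(1)[OF assms(1,2)] successively_nth[of adj "path u w" k] by (simp add: simple_path_def)
  show "path u (path u w ! Suc k) = path u (path u w ! k) @ [path u w ! Suc k]"
    using node_at_dist(4)[OF assms(1,2), of k] node_at_dist(4)[OF assms(1,2), of "Suc k"] assms(3) lt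
    by (simp add: take_Suc_conv_app_nth)
qed

text \<open>The last entry of \<open>seq T c x\<close> is the port at \<open>x\<close> leading back
  towards \<open>c\<close>, and ports at \<open>x\<close> are distinct. For \<open>x = c\<close> the
  sequence is empty and its \<open>last\<close> meaningless, but every edge leads away.\<close>

lemma port_forward:
  assumes "c \<in> N" "x \<in> N" "adj x y"
  shows "path c y = path c x @ [y] \<longleftrightarrow> x = c \<or> port T x y \<noteq> last (seq T c x)"
proof (cases "path c y = path c x @ [y]")
  case True
  have "port T x y \<noteq> last (seq T c x)" if xc: "x \<noteq> c"
  proof
    assume eq: "port T x y = last (seq T c x)"
    obtain u where u: "adj u x" "path c x = path c u @ [x]" "u \<in> N"
      using path_last_step[OF assms(1,2)] xc by metis
    have "last (seq T c x) = port T x u" using seq_step[OF assms(1) u(1,2)] by simp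
    then have "y = u" using port_inj[OF assms(3), of u] eq u(1) adj_commute by simp
    then show False using True u(2) by simp
  qed
  then show ?thesis using True by blast
next
  case False
  then have x: "path c x = path c y @ [x]" using path_step[OF assms(1,3)] by blast
  have yx: "adj y x" using assms(3) adj_commute by blast
  have "y \<in> N" using adj_nodes assms(3) by blast
  then have "path c y \<noteq> []" using path_props(4) assms by blast
  then have "x \<noteq> c" using x assms(1) by auto
  moreover have "last (seq T c x) = port T x y" using seq_step[OF assms(1) yx x] by simp
  ultimately show ?thesis using False by simp
qed

text \<open>Links the prefixes used by the oracle to the form used in Stage 2. A prefix of even
  length is the full sequence of a node on the path; one of odd length ends with a port by which the
  path goes on, and such ports can be read off the degree even where the edge is outside the
  view.\<close>

lemma prefix_seq_iff:
  assumes c: "c \<in> N"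
  shows "(\<exists>w\<in>N. prefix s (seq T c w)) \<longleftrightarrow>
    (\<exists>x\<in>N. s = seq T c x \<or> (\<exists>q<degree T x. (x = c \<or> q \<noteq> last (seq T c x)) \<and> s = seq T c x @ [q]))"
proof
  assume "\<exists>w\<in>N. prefix s (seq T c w)"
  then obtain w where w: "w \<in> N" "prefix s (seq T c w)" by blast
  define k where "k = length s div 2"
  have s: "s = take (length s) (seq T c w)" using w(2) by (metis append_eq_conv_conj prefixE)
  have len: "length s \<le> 2 * d c w" using prefix_length_le[OF w(2)] by (simp add: length_seq)
  define x where "x = path c w ! k"
  have k: "k \<le> d c w" using len by (simp add: k_def)
  have x: "x \<in> N" "seq T c x = take (2 * k) (seq T c w)"
    using node_at_dist(1)[OF c w(1) k] seq_take[OF c w(1) k] by (simp_all add: x_def)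
  show "\<exists>x\<in>N. s = seq T c x \<or> (\<exists>q<degree T x. (x = c \<or> q \<noteq> last (seq T c x)) \<and> s = seq T c x @ [q])"
  proof (cases "even (length s)")
    case True
    then have "2 * k = length s" by (simp add: k_def)
    then show ?thesis using s x by metis
  next
    case False
    then have ls: "length s = Suc (2 * k)" by (simp add: k_def)
    then have kl: "k < d c w" using len by simp
    define y where "y = path c w ! Suc k"
    have y: "adj x y" "path c y = path c x @ [y]"
      using path_next[OF c w(1) kl] by (simp_all add: x_def y_def)
    have "take (2 * Suc k) (seq T c w) = seq T c x @ [port T x y, port T y x]"
      using seq_take[OF c w(1), of "Suc k"] kl seq_step[OF c y] by (simp add: y_def)
    then have "take (length s) (take (2 * Suc k) (seq T c w)) = take (length s) (seq T c x @ [port T x y, port T y x])"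
      by simp
    moreover have "length (seq T c x) = 2 * k" using x(2) len ls by (simp add: length_seq)
    ultimately have "s = seq T c x @ [port T x y]" using s ls by (simp add: min_def)
    moreover have "x = c \<or> port T x y \<noteq> last (seq T c x)" using port_forward[OF c x(1) y(1)] y(2) by simp
    ultimately show ?thesis using port_less[OF y(1)] x(1) by blast
  qed
next
  assume "\<exists>x\<in>N. s = seq T c x \<or> (\<exists>q<degree T x. (x = c \<or> q \<noteq> last (seq T c x)) \<and> s = seq T c x @ [q])"
  then obtain x where x: "x \<in> N"
    "s = seq T c x \<or> (\<exists>q<degree T x. (x = c \<or> q \<noteq> last (seq T c x)) \<and> s = seq T c x @ [q])" by blast
  from x(2) consider "s = seq T c x"
    | q where "q < degree T x" "x = c \<or> q \<noteq> last (seq T c x)" "s = seq T c x @ [q]" by blast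
  then show "\<exists>w\<in>N. prefix s (seq T c w)"
  proof cases
    case 1
    then show ?thesis using x by blast
  next
    case q: 2
    obtain y where y: "adj x y" "port T x y = q" using port_surj[OF x(1) q(1)] .
    then have "path c y = path c x @ [y]" using port_forward[OF c x(1) y(1)] q(2) by simp
    then have "seq T c y = s @ [port T y x]" using seq_step[OF c y(1)] y q(3) by simp
    then show ?thesis using adj_nodes[OF y(1)] by (metis prefixI)
  qed
qed

end

context central_tree
begin

lemma gateway_local:
  "v \<in> N \<Longrightarrow> gateway (2 * h - 1) (local_view T v (2 * h - 1)) g \<longleftrightarrow> is_arg_max (d v) (\<lambda>w. w \<in> common v) g"
  by (simp add: ball_view.gateway_V[OF ball_view_local] common_def ends_def)

text \<open>The gateway lies beyond the central edge but also on the path to \<open>z\<close>, which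
  would stay on the side of \<open>v\<close> if \<open>z\<close> did.\<close>

lemma separated_across:
  assumes sep: "separated T" and v: "v \<in> side a b" and z: "z \<in> ends v"
  shows "z \<in> side b a"
proof (rule ccontr)
  assume "z \<notin> side b a"
  then have za: "z \<in> side a b" using sides z by (auto simp: ends_def)
  have vn: "v \<in> N" using v side_nodes by blast
  obtain g where g: "is_arg_max (d v) (\<lambda>w. w \<in> common v) g" using gateway_ex[OF vn] by blast
  have "v \<in> common v" using vn path_props(5) by (auto simp: common_def ends_def)
  then have gz: "g \<in> N" "g \<in> set (path v z)" using gateway_on[OF vn z g] by auto
  have "{a, b} \<in> path_edges (path v g)"
    using sep[unfolded separated_def diam_simps central] g vn gateway_local[OF vn] by blast
  then have "g \<in> side b a" using edge_on_path_iff[OF adj_ab v gz(1)] by simp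
  then show False using side_convex[OF adj_ab v za] gz(2) side_disjoint by blast
qed

lemma separatedI:
  assumes "\<And>v z. v \<in> side a b \<Longrightarrow> z \<in> ends v \<Longrightarrow> z \<in> side b a"
    and "\<And>v z. v \<in> side b a \<Longrightarrow> z \<in> ends v \<Longrightarrow> z \<in> side a b"
  shows "separated T"
proof -
  interpret S: central_tree T b a h by (rule swap)
  have "{a, b} \<in> path_edges (path v g)"
    if "v \<in> N" "is_arg_max (d v) (\<lambda>w. w \<in> common v) g" for v g
  proof (cases "v \<in> side a b")
    case True
    then have "g \<in> side b a" using gateway_side that(2) assms(1) by blast
    then show ?thesis using cross(5)[OF adj_ab True] by simp
  next
    case False
    then have v: "v \<in> side b a" using sides that by blast
    then have "g \<in> side a b" using S.gateway_side that(2) assms(2) by blast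
    then show ?thesis using cross(5)[OF adj_ba v] by (simp add: insert_commute)
  qed
  then show ?thesis unfolding separated_def diam_simps central using gateway_local by blast
qed

end

text \<open>The run at a node on the side of \<open>a\<close>; nodes on the other side are covered
  by exchanging \<open>a\<close> and \<open>b\<close>.\<close>

locale odd_view = central_tree T a b h + ball_view T v r V f
  for T :: "'a ptree" and a b :: 'a and h :: nat and v :: 'a and r :: nat and V :: "'b pview" and f :: "'a \<Rightarrow> 'b" +
  assumes v_side: "v \<in> side a b" and r: "2 * h - 1 = r"
begin

lemma B_iff: "w \<in> B \<longleftrightarrow> w \<in> N \<and> d v w < 2 * h"
  using r h_pos by (auto simp: B_def)

lemma endless_ends: "endless r V ys \<longleftrightarrow> (\<exists>z\<in>ends v. ys = map f (path v z))"
  unfolding endless_V ends_def r by blast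

lemma gateway_common: "gateway r V y \<longleftrightarrow> (\<exists>g. y = f g \<and> is_arg_max (d v) (\<lambda>w. w \<in> common v) g)"
  unfolding gateway_V common_def ends_def mem_Collect_eq r ..

lemma diam_r: "diameter T - 2 = r" "(diameter T - 1) div 2 = h"
  using diam_simps r by auto

lemma d_va: "d v a \<le> h"
  using depth_a v_side by blast

lemma a_B: "a \<in> B"
  using d_va h_pos ab_nodes by (simp add: B_iff)

lemma common_B: "w \<in> common v \<Longrightarrow> w \<in> B"
  using h_pos by (auto simp: common_def B_iff)

lemma B_dist_a:
  assumes "d v a = h" "w \<in> B"
  shows "d w a \<le> h"
proof (cases "w \<in> side a b")
  case True
  then show ?thesis using depth_a by blast
next
  case False
  have wn: "w \<in> N" "d v w \<le> 2 * h - 1" using assms by (auto simp: B_iff)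
  then have w: "w \<in> side b a" using sides False by blast
  have "d v w = Suc (h + d b w)" using cross(2)[OF adj_ab v_side w] assms(1) by simp
  moreover have "d w a = Suc (d w b)" using side_dist[OF adj_ba w] .
  ultimately show ?thesis using wn dist_commute[OF wn(1) ab_nodes(2)] by simp
qed

text \<open>The gateway is at or beyond \<open>a\<close>, so only the distance from \<open>v\<close>
  to \<open>a\<close> has to be recognised. If it is \<open>h\<close>, all visible nodes are within
  \<open>h\<close> of \<open>a\<close>, and none is further from the gateway than \<open>v\<close>.
  If it is \<open>h - 1\<close>, the gateway is across, and a deepest node on the side of
  \<open>v\<close> is visible and further from the gateway.\<close>

lemma stage1_endless:
  assumes "ends v \<noteq> {}"
  shows "stage1 (diameter T) V = ({}, f a)"
proof -
  obtain z where z: "z \<in> ends v" using assms by blast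
  define g where "g = (THE g. is_arg_max (d v) (\<lambda>w. w \<in> common v) g)"
  note ex1 = gateway_unique[OF root_node z]
  have g: "is_arg_max (d v) (\<lambda>w. w \<in> common v) g" unfolding g_def by (rule theI'[OF ex1])
  have "(THE g. gateway r V g) = f g"
    unfolding g_def by (rule the_image[OF ex1 gateway_common])
  moreover
  have a: "a \<in> common v"
    using endless_end(1)[OF v_side] d_va h_pos ab_nodes by (simp add: common_def)
  have ag: "g \<in> N" "a \<in> set (path v g)" using gateway_on[OF root_node z g a] by auto
  have gB: "g \<in> B" using g common_B by (simp add: is_arg_max_linorder)
  have dg: "d v g = d v a + d a g" using dist_on_path[OF root_node ag] .
  have "d v a = (if \<exists>w\<in>B. d v g < d w g then h - 1 else h)"
  proof (cases "d v a = h")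
    case True
    have "d w g \<le> d v g" if "w \<in> B" for w
      using dist_triangle[of w a g] B_dist_a[OF True that] dg True B_nodes[OF that] ab_nodes ag by simp
    then have "\<not> (\<exists>w\<in>B. d v g < d w g)" by (meson not_less)
    then show ?thesis using True by simp
  next
    case False
    then have across: "\<And>z. z \<in> ends v \<Longrightarrow> z \<in> side b a" and va: "Suc (d v a) = h"
      using endless_end(2)[OF v_side] z by blast+
    have "b \<in> set (path v g)"
      using gateway_on(3)[OF root_node z g common_across[OF v_side z across]] .
    then have gb: "g \<in> side b a" using same_side_edge(2)[OF adj_ab v_side] sides ag(1) by blast
    obtain w where w: "w \<in> side a b" "d w a = h" using deep_a by blast
    have wn: "w \<in> N" using w side_nodes by blast
    have "d v w \<le> d v a + d a w" using dist_triangle[OF root_node ab_nodes(1) wn] .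
    then have "w \<in> B" using wn w(2) va dist_commute[OF wn ab_nodes(1)] by (simp add: B_iff)
    moreover have "d v g < d w g"
      using cross(2)[OF adj_ab w(1) gb] cross(2)[OF adj_ab v_side gb] w(2) va by simp
    ultimately show ?thesis using va by auto
  qed
  moreover have "path v g ! d v a = a" using path_nth[OF root_node ag] .
  moreover have "d v a < length (path v g)" using length_path[OF root_node ag(1)] dg by simp
  moreover have "(\<exists>w\<in>nodes V. tdist V w (f g) > tdist V (f v) (f g)) \<longleftrightarrow> (\<exists>w\<in>B. d v g < d w g)"
    using tdist_V gB root_B by (auto simp: nodes_V B_def)
  moreover have "\<exists>xs. endless r V xs" using z endless_ends by blast
  ultimately show ?thesis
    unfolding stage1_def Let_def diam_r root_V using tpath_V[OF root_B gB] by (simp cong: if_cong)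
qed

lemma whole:
  assumes "ends v = {}" shows "B = N"
proof -
  have "d v w < 2 * h" if "w \<in> N" for w
  proof -
    have "\<not> 2 * h - 1 < d v w" using far_end[OF root_node that] assms by blast
    then show ?thesis using h_pos by arith
  qed
  then show ?thesis by (auto simp: B_iff)
qed

lemma stage1_whole:
  assumes "ends v = {}"
  shows "stage1 (diameter T) V = ({f a, f b}, f a)"
proof -
  note BN = whole[OF assms]
  have nV: "nodes V = f ` N" using nodes_V BN by (simp add: B_def)
  have "{tdist V u w |u w. u \<in> nodes V \<and> w \<in> nodes V} = {tdist V (f u) (f w) |u w. u \<in> N \<and> w \<in> N}"
    unfolding nV by blast
  also have "\<dots> = {d u w |u w. u \<in> N \<and> w \<in> N}"
    using tdist_V BN by (intro Collect_cong) metis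
  finally have dV: "diameter V = diameter T" by (simp add: diameter_def)
  have mid: "{f a, f b} = {ys ! h, ys ! Suc h}" if ys: "simple_path V ys" "length ys = Suc (diameter T)" for ys
  proof -
    obtain xs where xs: "ys = map f xs" "simple_path T xs" using ys(1) by (auto simp: simple_path_V)
    then have "f ` {a, b} = f ` {xs ! h, xs ! Suc h}" using middle[of xs] ys(2) by simp
    then show ?thesis using xs(1) ys(2) diam by simp
  qed
  have ce: "central_edge V = {f a, f b}"
    unfolding central_edge_def dV diam_simps
  proof (rule the_equality)
    show "\<forall>xs. simple_path V xs \<and> length xs = Suc (diameter T) \<longrightarrow> {f a, f b} = {xs ! h, xs ! Suc h}"
      using mid by blast
    fix e assume e: "\<forall>xs. simple_path V xs \<and> length xs = Suc (diameter T) \<longrightarrow> e = {xs ! h, xs ! Suc h}"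
    obtain xs where xs: "simple_path T xs" "length xs = Suc (diameter T)" by (rule diameter_path)
    moreover have "set xs \<subseteq> B" using xs(1) BN by (simp add: simple_path_def)
    ultimately have "simple_path V (map f xs)" using simple_path_V by blast
    then show "e = {f a, f b}" using e mid[of "map f xs"] xs by simp
  qed
  have "tdist V (f v) (f a) = d v a" "tdist V (f v) (f b) = Suc (d v a)"
    using tdist_V root_B BN ab_nodes side_dist[OF adj_ab v_side] by auto
  then have "(THE c. is_arg_min (tdist V (f v)) (\<lambda>c. c \<in> {f a, f b}) c) = f a"
    by (intro the_equality) (auto simp: is_arg_min_linorder)
  moreover have "\<not> (\<exists>xs. endless r V xs)" using assms endless_ends by blast
  ultimately show ?thesis
    unfolding stage1_def Let_def diam_r root_V ce by simp
qed

text \<open>If some endless path exists, all of them cross the central edge within the view; if none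
  exists, the view is the whole tree.\<close>

lemma separated_b_B:
  assumes "separated T" shows "b \<in> B"
proof (cases "ends v = {}")
  case True
  then show ?thesis using whole ab_nodes by simp
next
  case False
  then show ?thesis using common_across[OF v_side] separated_across[OF assms v_side] common_B by blast
qed

text \<open>The path to an invisible node on the same side would contain the end of an endless path
  that does not cross, contradicting separation. So Stage 2 sees the entire side that the oracle
  listed.\<close>

lemma separated_side_B:
  assumes "separated T" shows "side a b \<subseteq> B"
proof
  fix w assume w: "w \<in> side a b"
  have wn: "w \<in> N" using w side_nodes by blast
  show "w \<in> B"
  proof (rule ccontr)
    assume "w \<notin> B"
    then have far: "d v w > 2 * h - 1" using wn h_pos by (auto simp: B_iff)
    then have "path v w ! (2 * h - 1) \<in> side b a"
      using separated_across[OF assms v_side] far_end[OF root_node wn] by blast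
    moreover have "path v w ! (2 * h - 1) \<in> side a b"
      using side_convex[OF adj_ab v_side w] node_at_dist(2)[OF root_node wn, of "2 * h - 1"] far by auto
    ultimately show False using side_disjoint by blast
  qed
qed

text \<open>All endless paths cross, so the central edge qualifies. For uniqueness, the path to one
  \<open>z\<close> consists of the path to \<open>a\<close>, the central edge and the path from
  \<open>b\<close>; an edge on the first part is excluded by definition, and the last part does not
  meet \<open>a\<close>.\<close>

lemma exit_edge:
  assumes sep: "separated T" and "ends v \<noteq> {}"
  shows "exit_edge (diameter T) V (f a) = {f a, f b}"
  unfolding exit_edge_def diam_r root_V tpath_V[OF root_B a_B]
proof (rule the_equality)
  note bB = separated_b_B[OF sep]
  have across: "z \<in> side b a" if "z \<in> ends v" for z using separated_across[OF sep v_side that] .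
  have zB: "z \<in> B" if "z \<in> ends v" for z using that h_pos by (auto simp: ends_def B_iff)
  have 1: "{f a, f b} \<in> edges V" using edges_V[of a b] a_B bB adj_ab by (simp add: B_def)
  have 2: "{f a, f b} \<in> path_edges (map f (path v z))" if "z \<in> ends v" for z
    using image_pair_in_path_edges[OF a_B bB path_B[OF root_B zB[OF that]]]
      cross(5)[OF adj_ab v_side across[OF that]] by simp
  have 3: "{f a, f b} \<notin> path_edges (map f (path v a))"
    using image_pair_in_path_edges[OF a_B bB path_B[OF root_B a_B]]
      same_side_edge(1)[OF adj_ab v_side side_self[OF adj_ab]] by simp
  show "{f a, f b} \<in> edges V \<and> f a \<in> {f a, f b} \<and>
     (\<forall>xs. endless r V xs \<longrightarrow> {f a, f b} \<in> path_edges xs) \<and>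
     {f a, f b} \<notin> path_edges (map f (path v a))"
    using 1 2 3 endless_ends by auto
  fix e assume "e \<in> edges V \<and> f a \<in> e \<and> (\<forall>xs. endless r V xs \<longrightarrow> e \<in> path_edges xs) \<and>
     e \<notin> path_edges (map f (path v a))"
  then have e: "f a \<in> e" "\<And>z. z \<in> ends v \<Longrightarrow> e \<in> path_edges (map f (path v z))"
    "e \<notin> path_edges (map f (path v a))" using endless_ends by auto
  obtain z where z: "z \<in> ends v" using assms(2) by blast
  then obtain e' where e': "e = f ` e'" "e' \<in> path_edges (path v z)"
    using e(2)[OF z] by (auto simp: path_edges_map)
  have zN: "z \<in> N" using z by (simp add: ends_def)
  have "e' \<subseteq> B" using path_edges_subset[OF e'(2)] path_B[OF root_B zB[OF z]] by blast
  then have ae: "a \<in> e'" using e(1) e'(1) inj_on_image_mem_iff[OF inj_B a_B] by simp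
  obtain xs where xs: "path v a = xs @ [a]"
    using path_props(3,4)[OF root_node ab_nodes(1)] by (metis append_butlast_last_id)
  obtain ys where ys: "path b z = b # ys"
    using path_props(2,4)[OF ab_nodes(2) zN] by (metis list.collapse)
  have "path v z = xs @ a # (b # ys)" using cross(1)[OF adj_ab v_side across[OF z]] xs ys by simp
  then have "e' \<in> path_edges (path v a) \<or> e' = {a, b} \<or> e' \<in> path_edges (path b z)"
    using e'(2) xs ys path_edges_append[of xs a "b # ys"] by (auto simp: path_edges_Cons)
  moreover have "e' \<notin> path_edges (path v a)" using e(3) e'(1) by (auto simp: path_edges_map)
  moreover have "e' \<notin> path_edges (path b z)"
    using same_side_edge(2)[OF adj_ba side_self[OF adj_ba] across[OF z]] ae path_edges_subset by blast
  ultimately show "e = {f a, f b}" using e'(1) by auto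
qed

text \<open>The algorithm tests paths from \<open>v\<close> and the oracle paths from
  \<open>a\<close>. As both start on the same side, avoiding the central edge selects the same
  nodes.\<close>

lemma stage2_separated:
  assumes sep: "separated T" and e: "e = {f a, f b} \<or> e = {} \<and> ends v \<noteq> {}"
  shows "stage2_list (diameter T) True V e (f a) = oracle_list T a"
proof -
  note bB = separated_b_B[OF sep]
  have e': "(if e = {} then exit_edge (diameter T) V (f a) else e) = {f a, f b}"
    using e exit_edge[OF sep] by auto
  have "{seq V (f a) w |w. w \<in> nodes V \<and> {f a, f b} \<notin> path_edges (tpath V (f v) w)} =
    {seq V (f a) (f w) |w. w \<in> B \<and> {f a, f b} \<notin> path_edges (tpath V (f v) (f w))}"
    by (auto simp: nodes_V B_def)
  also have "\<dots> = {seq T a w |w. w \<in> B \<and> {a, b} \<notin> path_edges (path v w)}"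
    using seq_V[OF a_B] tpath_V[OF root_B] image_pair_in_path_edges[OF a_B bB path_B[OF root_B]]
    by (metis (no_types, lifting))
  also have "\<dots> = {seq T a w |w. w \<in> side a b}"
    using edge_on_path_iff[OF adj_ab v_side] B_nodes sides side_disjoint separated_side_B[OF sep] by blast
  also have "\<dots> = {seq T a w |w. w \<in> N \<and> {a, b} \<notin> path_edges (path a w)}"
    using edge_on_path_iff[OF adj_ab side_self[OF adj_ab]] side_nodes sides side_disjoint by blast
  finally show ?thesis
    unfolding stage2_list_def oracle_list_def Let_def e' root_V central using sep by simp
qed

lemma stage2_not_separated:
  assumes sep: "\<not> separated T"
  shows "stage2_list (diameter T) False V e (f a) = oracle_list T a"
proof -
  define R where "R = (\<lambda>s x. s = seq T a x \<or>
    (\<exists>q<degree T x. (x = a \<or> q \<noteq> last (seq T a x)) \<and> s = seq T a x @ [q]))"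
  \<comment> \<open>A sequence of length at most \<open>2 * h - 1\<close> needs only a node within
    \<open>h - 1\<close> of \<open>a\<close>, which is within \<open>2 * h - 1\<close> of
    \<open>v\<close>.\<close>
  have inB: "x \<in> B" if "length s \<le> 2 * h - 1" "x \<in> N" "R s x" for s x
  proof -
    have "2 * d a x \<le> 2 * h - 1" using that by (auto simp: R_def length_seq)
    then have "d a x \<le> h - 1" by simp
    then show ?thesis using dist_triangle[OF root_node ab_nodes(1) that(2)] d_va that(2) h_pos by (simp add: B_iff)
  qed
  have "(s = seq V (f a) (f x) \<or> (\<exists>q<vdeg V (f x). (f x = f a \<or> q \<noteq> last (seq V (f a) (f x))) \<and>
      s = seq V (f a) (f x) @ [q])) \<longleftrightarrow> R s x" if "x \<in> B" for s x
    using seq_V[OF a_B that] f_eq_iff[OF that a_B] degree_V that by (simp add: R_def B_def)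
  then have "(\<exists>w\<in>nodes V. s = seq V (f a) w \<or> (\<exists>q<vdeg V w. (w = f a \<or> q \<noteq> last (seq V (f a) w)) \<and>
      s = seq V (f a) w @ [q])) \<longleftrightarrow> (\<exists>x\<in>B. R s x)" for s
    by (simp add: nodes_V B_def)
  moreover have "(\<exists>w\<in>N. prefix s (seq T a w)) \<longleftrightarrow> (\<exists>x\<in>N. R s x)" for s
    unfolding R_def by (rule prefix_seq_iff[OF ab_nodes(1)])
  moreover have "{s. length s \<le> 2 * h - 1 \<and> (\<exists>x\<in>B. R s x)} = {s. length s \<le> 2 * h - 1 \<and> (\<exists>x\<in>N. R s x)}"
    using inB B_nodes by blast
  ultimately show ?thesis
    unfolding stage2_list_def oracle_list_def diam_simps using sep by simp
qed

lemma OddElect_output: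
  assumes adv: "dec_advice A = adv" "adv_D adv = diameter T" "adv_sep adv \<longleftrightarrow> separated T"
  shows "OddElect A V = (let s = jth (oracle_list T a) (adv_j adv) in
    if adv_k adv < length s \<and> s ! adv_k adv = adv_m adv then out_ports T (path v a)
    else out_ports T (path v a) @ [adv_p adv])"
proof -
  obtain e where e: "stage1 (diameter T) V = (e, f a)" "e = {f a, f b} \<or> e = {} \<and> ends v \<noteq> {}"
    using stage1_whole stage1_endless by (cases "ends v = {}") auto
  have "stage2_list (diameter T) (separated T) V e (f a) = oracle_list T a"
    using stage2_separated[OF _ e(2)] stage2_not_separated by (cases "separated T") auto
  then show ?thesis
    unfolding OddElect_def adv Let_def e(1) root_V by (simp add: out_ports_V[OF root_B a_B])
qed

end

section \<open>The advice\<close>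

lemma dec_enc_nat: "dec_nat (enc_nat n @ rest) = (n, rest)"
proof (induction n rule: less_induct)
  case (less n)
  show ?case
  proof (cases "n = 0")
    case True
    then show ?thesis by (simp add: enc_nat.simps[of 0])
  next
    case False
    then have "dec_nat (enc_nat (n div 2) @ rest) = (n div 2, rest)" using less by simp
    then show ?thesis using False by (simp add: enc_nat.simps[of n])
  qed
qed

lemma dec_enc_advice: "dec_advice (enc_advice adv) = adv"
  using dec_enc_nat[of _ "[]"] by (simp add: dec_advice_def enc_advice_def dec_enc_nat)

lemma length_enc_nat: "n < 2 ^ k \<Longrightarrow> length (enc_nat n) \<le> 2 * k + 1"
proof (induction k arbitrary: n)
  case 0
  then show ?case by (simp add: enc_nat.simps[of 0])
next
  case (Suc k)
  show ?case
  proof (cases "n = 0")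
    case True
    then show ?thesis by (simp add: enc_nat.simps[of 0])
  next
    case False
    have "n div 2 < 2 ^ k" using Suc.prems by auto
    then show ?thesis using Suc.IH[of "n div 2"] False by (simp add: enc_nat.simps[of n])
  qed
qed

text \<open>With \<open>m\<close> the rounded-up logarithm, \<open>3 * n^2\<close> is below
  \<open>2 ^ (2 * m + 2)\<close>, so a number takes at most \<open>4 * m + 5\<close> bits and the
  advice at most \<open>20 * m + 26\<close>. This is at most \<open>20 * log 2 n + 46\<close>; as
  \<open>log 2 n\<close> is at least 2, the constant 50 leaves room.\<close>

lemma length_enc_advice:
  assumes n: "n \<ge> 4"
    and le: "adv_D adv \<le> 3 * n^2" "adv_j adv \<le> 3 * n^2" "adv_k adv \<le> 3 * n^2" "adv_m adv \<le> 3 * n^2" "adv_p adv \<le> 3 * n^2"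
  shows "real (length (enc_advice adv)) \<le> 50 * log 2 (real n)"
proof -
  define m where "m = nat \<lceil>log 2 (real n)\<rceil>"
  have l2: "log 2 (real n) \<ge> 2" using n by (simp add: le_log_iff)
  then have m: "log 2 (real n) \<le> real m" "real m \<le> log 2 (real n) + 1" by (simp_all add: m_def)
  have "real n \<le> 2 powr real m" using m(1) n by (simp add: log_le_iff)
  then have "real n \<le> real (2 ^ m)" by (simp add: powr_realpow)
  then have nm: "n \<le> 2 ^ m" using of_nat_le_iff by blast
  have "n ^ 2 \<le> (2 ^ m) ^ 2" using nm by (rule power_mono) simp
  moreover have "(2::nat) ^ (2 * m + 2) = 4 * (2 ^ m) ^ 2"
    by (simp add: power_add mult.commute flip: power_mult)
  moreover have "(2 ^ m) ^ 2 > (0::nat)" by simp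
  ultimately have lt: "3 * n ^ 2 < 2 ^ (2 * m + 2)" by linarith
  have enc: "length (enc_nat x) \<le> 4 * m + 5" if "x \<le> 3 * n ^ 2" for x
    using length_enc_nat[OF order.strict_trans1[OF that lt]] by simp
  have "length (enc_advice adv) \<le> 1 + 5 * (4 * m + 5)"
    using le[THEN enc] by (simp add: enc_advice_def)
  then have "real (length (enc_advice adv)) \<le> real (1 + 5 * (4 * m + 5))" by (rule of_nat_mono)
  then show ?thesis using m(2) l2 by simp
qed

lemma jth_in: "jth L j \<in> insert [] (set L)"
  by (auto simp: jth_def)

lemma (in tree) port_less_card: "adj u w \<Longrightarrow> port T u w < card N"
  using port_less degree_le less_le_trans by blast

lemma (in tree) all_ports_less: "successively adj xs \<Longrightarrow> q \<in> set (all_ports T xs) \<Longrightarrow> q < card N"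
proof (induction xs rule: induct_list012)
  case (3 x y zs)
  have "port T x y < card N" "port T y x < card N"
    using "3.prems"(1) port_less_card[of x y] port_less_card[of y x] adj_commute[of x y] by auto
  then show ?case using 3 by auto
qed simp_all

lemma (in tree) seq_less: "u \<in> N \<Longrightarrow> w \<in> N \<Longrightarrow> q \<in> set (seq T u w) \<Longrightarrow> q < card N"
  unfolding seq_def using all_ports_less path_props(1) by (auto simp: simple_path_def)

lemma (in tree) length_seq_le: "u \<in> N \<Longrightarrow> w \<in> N \<Longrightarrow> length (seq T u w) < 2 * card N"
  using dist_le_diameter[of u w] diameter_less by (simp add: length_seq)

section \<open>The oracle lists as sets of sequences\<close>

context central_tree
begin

definition codes :: "'a \<Rightarrow> nat list set" where
  "codes c = (if separated T then {seq T c w | w. w \<in> N \<and> central_edge T \<notin> path_edges (path c w)}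
     else {s. length s \<le> 2 * h - 1 \<and> (\<exists>w\<in>N. prefix s (seq T c w))})"

lemmas codes_eq = codes_def[unfolded central]

text \<open>A code is a prefix of a node's sequence and so is given by a node and a length. This
  yields finiteness and, by \<open>n * (2 * n + 1)\<close>, the bound \<open>3 * n^2\<close> on
  positions.\<close>

lemma codes_subset: "codes c \<subseteq> (\<lambda>(w, i). take i (seq T c w)) ` (N \<times> {..2 * card N})" if "c \<in> N"
proof
  fix s assume "s \<in> codes c"
  then obtain w where w: "w \<in> N" "prefix s (seq T c w)" by (auto simp: codes_eq split: if_splits)
  then have "s = take (length s) (seq T c w)" by (metis append_eq_conv_conj prefixE)
  moreover have "length s \<le> 2 * card N"
    using prefix_length_le[OF w(2)] length_seq_le[OF that w(1)] by simp
  ultimately show "s \<in> (\<lambda>(w, i). take i (seq T c w)) ` (N \<times> {..2 * card N})" using w by force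
qed

lemma finite_codes: "c \<in> N \<Longrightarrow> finite (codes c)"
  by (rule finite_subset[OF codes_subset]) (use finite_nodes in auto)

lemma oracle_list_codes: "oracle_list T c = sorted_list_of_set (codes c)"
  by (simp add: oracle_list_def codes_eq central diam_simps del: One_nat_def)

lemma set_oracle_list: "c \<in> N \<Longrightarrow> set (oracle_list T c) = codes c"
  by (simp add: oracle_list_codes finite_codes)

lemma length_oracle_list:
  assumes "c \<in> N" shows "length (oracle_list T c) \<le> 3 * (card N)^2"
proof -
  have "length (oracle_list T c) = card (codes c)" by (simp add: oracle_list_codes)
  also have "\<dots> \<le> card (N \<times> {..2 * card N})"
    using surj_card_le[OF _ codes_subset[OF assms]] finite_nodes by simp
  also have "\<dots> = card N * Suc (2 * card N)" by (simp add: card_cartesian_product)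
  also have "\<dots> \<le> 3 * (card N)^2"
    using diameter_less by (cases "card N") (simp_all add: power2_eq_square algebra_simps)
  finally show ?thesis .
qed

text \<open>Covers the default of \<open>jth\<close>: when the list of \<open>b\<close> is too
  short, the sequence compared with is the empty one, which is a code as well.\<close>

lemma Nil_codes: "[] \<in> codes b"
proof -
  have "seq T b b = []" "{a, b} \<notin> path_edges (path b b)" using ab_nodes by simp_all
  then show ?thesis using ab_nodes unfolding codes_eq by force
qed

text \<open>Cutting the path of \<open>t\<close> after as many edges as \<open>s\<close> describes
  gives a node on the same side of the central edge. Hence a code missing from the other list is
  never a prefix of a code there, and so must differ from it at an existing position.\<close>

lemma prefix_codes:
  assumes s: "s \<in> codes a" and t: "t \<in> codes b" and st: "prefix s t"
  shows "s \<in> codes b"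
proof (cases "separated T")
  case False
  then show ?thesis using s t st unfolding codes_eq by (auto intro: prefix_order.trans)
next
  case True
  obtain w where w: "w \<in> N" "s = seq T a w" using s True by (auto simp: codes_eq)
  obtain w' where w': "w' \<in> N" "t = seq T b w'" "{a, b} \<notin> path_edges (path b w')"
    using t True by (auto simp: codes_eq)
  have w'b: "w' \<in> side b a"
    using edge_on_path_iff[OF adj_ba side_self[OF adj_ba] w'(1)] w'(3) sides[OF w'(1)]
    by (auto simp: insert_commute)
  have le: "d a w \<le> d b w'" using prefix_length_le[OF st] w w' by (simp add: length_seq)
  define x where "x = path b w' ! d a w"
  have x: "x \<in> N" "x \<in> set (path b w')" "seq T b x = take (2 * d a w) t"
    using node_at_dist[OF ab_nodes(2) w'(1) le] seq_take[OF ab_nodes(2) w'(1) le] w'(2) by (simp_all add: x_def)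
  have "length s = 2 * d a w" using w by (simp add: length_seq)
  then have "seq T b x = s" using x(3) st by (metis append_eq_conv_conj prefixE)
  moreover have "x \<in> side b a" using side_convex[OF adj_ba side_self[OF adj_ba] w'b] x(2) by blast
  then have "{a, b} \<notin> path_edges (path b x)"
    using same_side_edge(1)[OF adj_ba side_self[OF adj_ba]] by (simp add: insert_commute)
  ultimately show ?thesis using True x(1) unfolding codes_eq by auto
qed

end

text \<open>Fixes the oracle's choice such that \<open>a\<close> is the end whose list contains the
  distinguishing sequence; \<open>a\<close> is then the leader.\<close>

locale advised_tree = central_tree +
  fixes adv :: advice and s t :: "nat list"
  assumes adv_D: "adv_D adv = diameter T"
    and adv_sep: "adv_sep adv \<longleftrightarrow> separated T"
    and adv_j: "1 \<le> adv_j adv" "adv_j adv \<le> length (oracle_list T a)"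
    and s: "s = jth (oracle_list T a) (adv_j adv)"
    and t: "t = jth (oracle_list T b) (adv_j adv)"
    and s_new: "s \<notin> set (oracle_list T b)"
    and adv_k: "adv_k adv = (GREATEST k. k \<le> length s \<and> k \<le> length t \<and> take k s = take k t)"
    and adv_m: "adv_m adv = s ! adv_k adv"
    and adv_p: "adv_p adv = port T b a"
begin

lemma s_codes: "s \<in> codes a"
  using adv_j ab_nodes unfolding s jth_def by (simp flip: set_oracle_list)

lemma k_props: "adv_k adv \<le> length s" "adv_k adv \<le> length t" "take (adv_k adv) s = take (adv_k adv) t"
  and k_max: "\<lbrakk>k \<le> length s; k \<le> length t; take k s = take k t\<rbrakk> \<Longrightarrow> k \<le> adv_k adv"
proof -
  let ?P = "\<lambda>k. k \<le> length s \<and> k \<le> length t \<and> take k s = take k t"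
  have "?P (adv_k adv)" unfolding adv_k by (rule GreatestI_nat[of ?P 0 "length s"]) auto
  then show "adv_k adv \<le> length s" "adv_k adv \<le> length t" "take (adv_k adv) s = take (adv_k adv) t" by auto
  show "k \<le> adv_k adv" if "k \<le> length s" "k \<le> length t" "take k s = take k t"
    unfolding adv_k by (rule Greatest_le_nat[of ?P k "length s"]) (use that in auto)
qed

text \<open>Otherwise \<open>adv_m\<close> would be the junk value of an index that is out of range.\<close>

lemma k_less: "adv_k adv < length s"
proof (rule ccontr)
  assume "\<not> adv_k adv < length s"
  then have "s = take (length s) t" using k_props by simp
  then have "prefix s t" by (metis take_is_prefix)
  moreover have "t \<in> codes b" using jth_in[of "oracle_list T b" "adv_j adv"] Nil_codes ab_nodes
    by (auto simp: t set_oracle_list)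
  ultimately show False using prefix_codes[OF s_codes] s_new set_oracle_list[OF ab_nodes(2)] by blast
qed

text \<open>Agreement at this position would give a longer common prefix. The negation also covers a
  \<open>t\<close> that ends there, so candidates \<open>b\<close> are rejected in either
  case.\<close>

lemma k_differs: "\<not> (adv_k adv < length t \<and> t ! adv_k adv = adv_m adv)"
proof
  assume "adv_k adv < length t \<and> t ! adv_k adv = adv_m adv"
  then have "Suc (adv_k adv) \<le> adv_k adv"
    using k_less k_props adv_m by (intro k_max) (auto simp: take_Suc_conv_app_nth)
  then show False by simp
qed

text \<open>Nodes on the side of \<open>a\<close> find \<open>s\<close> and stop at
  \<open>a\<close>; those on the side of \<open>b\<close> find \<open>t\<close>, which fails the
  test, and append the port leading from \<open>b\<close> to \<open>a\<close>.\<close>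

lemma leader: "leader_election T (\<lambda>v. OddElect (enc_advice adv) (view T v (diameter T - 2)))"
proof -
  interpret S: central_tree T b a h by (rule swap)
  have "out_ports T (path v a) = OddElect (enc_advice adv) (view T v (2 * h - 1))" if v: "v \<in> N" for v
  proof (cases "v \<in> side a b")
    case True
    interpret V: odd_view T a b h v "2 * h - 1" "view T v (2 * h - 1)" "\<lambda>w. out_ports T (path v w)"
      by (intro odd_view.intro ball_view_view odd_view_axioms.intro central_tree_axioms v True refl)
    show ?thesis
      using V.OddElect_output[OF dec_enc_advice adv_D adv_sep] k_less adv_m by (simp add: s[symmetric])
  next
    case False
    then have vb: "v \<in> side b a" using sides v by blast
    interpret V: odd_view T b a h v "2 * h - 1" "view T v (2 * h - 1)" "\<lambda>w. out_ports T (path v w)"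
      by (intro odd_view.intro ball_view_view odd_view_axioms.intro swap v vb refl)
    have "path v a = path v b @ [a]" using vb by (simp add: side_def)
    then have "out_ports T (path v a) = out_ports T (path v b) @ [port T b a]"
      by (rule out_ports_step[OF v adj_ba])
    then show ?thesis
      using V.OddElect_output[OF dec_enc_advice adv_D adv_sep] k_differs adv_p by (simp add: t[symmetric] Let_def)
  qed
  then show ?thesis
    unfolding leader_election_def diam_simps using path_between_iff ab_nodes(1) by metis
qed

lemma advice_bounds:
  "adv_D adv \<le> 3 * (card N)^2" "adv_j adv \<le> 3 * (card N)^2" "adv_k adv \<le> 3 * (card N)^2"
  "adv_m adv \<le> 3 * (card N)^2" "adv_p adv \<le> 3 * (card N)^2"
proof -
  have sq: "x \<le> 3 * (card N)^2" if "x \<le> 2 * card N" for x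
  proof -
    have "card N \<le> (card N)^2" by (simp add: power2_nat_le_imp_le power2_eq_square)
    then show ?thesis using that by linarith
  qed
  obtain w i where w: "w \<in> N" "s = take i (seq T a w)"
    using codes_subset[OF ab_nodes(1)] s_codes by auto
  show "adv_D adv \<le> 3 * (card N)^2" using adv_D diameter_less by (intro sq) simp
  show "adv_j adv \<le> 3 * (card N)^2" using adv_j length_oracle_list[OF ab_nodes(1)] by simp
  show "adv_k adv \<le> 3 * (card N)^2" using k_less w length_seq_le[OF ab_nodes(1) w(1)] by (intro sq) simp
  have "adv_m adv \<in> set s" using adv_m k_less by simp
  then have "adv_m adv < card N" using seq_less[OF ab_nodes(1) w(1)] w(2) set_take_subset by fast
  then show "adv_m adv \<le> 3 * (card N)^2" by (intro sq) simp
  have "adv_p adv < card N" using adv_p port_less_card[OF adj_ba] by simp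
  then show "adv_p adv \<le> 3 * (card N)^2" by (intro sq) simp
qed

end

text \<open>The oracle may let either end provide the distinguishing sequence, hence the
  disjunction.\<close>

lemma (in central_tree) advice_for_iff:
  "advice_for T adv \<longleftrightarrow> (\<exists>s t. advised_tree T a b h adv s t \<or> advised_tree T b a h adv s t)"
proof
  assume "advice_for T adv"
  then obtain x y where *: "adv_D adv = diameter T" "adv_sep adv \<longleftrightarrow> separated T"
    "central_edge T = {x, y}"
    "1 \<le> adv_j adv" "adv_j adv \<le> length (oracle_list T x)"
    "jth (oracle_list T x) (adv_j adv) \<notin> set (oracle_list T y)"
    "adv_k adv = (GREATEST k. k \<le> length (jth (oracle_list T x) (adv_j adv)) \<and>
       k \<le> length (jth (oracle_list T y) (adv_j adv)) \<and>
       take k (jth (oracle_list T x) (adv_j adv)) = take k (jth (oracle_list T y) (adv_j adv)))"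
    "adv_m adv = jth (oracle_list T x) (adv_j adv) ! adv_k adv"
    "adv_p adv = port T y x"
    unfolding advice_for_def Let_def by (elim conjE exE) (rule that; assumption)
  have xy: "x = a \<and> y = b \<or> x = b \<and> y = a" using *(3) central by (auto simp: doubleton_eq_iff)
  then have "central_tree T x y h" using central_tree_axioms swap by blast
  then have "advised_tree T x y h adv (jth (oracle_list T x) (adv_j adv)) (jth (oracle_list T y) (adv_j adv))"
    by (intro advised_tree.intro advised_tree_axioms.intro * refl)
  then show "\<exists>s t. advised_tree T a b h adv s t \<or> advised_tree T b a h adv s t" using xy by blast
next
  have "advice_for T adv" if "central_edge T = {x, y}" "x \<noteq> y" "advised_tree T x y h adv s t" for x y s t
  proof -
    interpret A: advised_tree T x y h adv s t by (rule that)
    show ?thesis unfolding advice_for_def Let_def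
      using that(1,2) A.adv_D A.adv_sep A.adv_j A.s A.t A.s_new A.adv_k A.adv_m A.adv_p by blast
  qed
  moreover have "a \<noteq> b" using adj_nodes[OF adj_ab] by blast
  moreover assume "\<exists>s t. advised_tree T a b h adv s t \<or> advised_tree T b a h adv s t"
  ultimately show "advice_for T adv" using central by (metis insert_commute)
qed

section \<open>Indistinguishable nodes\<close>

lemma longest_common_prefix_append:
  "longest_common_prefix (xs @ ys) (xs @ zs) = xs @ longest_common_prefix ys zs"
  by (induction xs) auto

lemma longest_common_prefix_Nil:
  "(ys \<noteq> [] \<Longrightarrow> zs \<noteq> [] \<Longrightarrow> hd ys \<noteq> hd zs) \<Longrightarrow> longest_common_prefix ys zs = []"
  by (cases ys; cases zs) auto

text \<open>Equality of views is equality of records, so ports and degrees must agree on arguments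
  outside the view too.\<close>

lemma anon_outside:
  "{x, y} \<notin> edges (anon V) \<Longrightarrow> port (anon V) x y = 0"
  "x \<notin> nodes (anon V) \<Longrightarrow> vdeg (anon V) x = 0"
  by (auto simp: anon_def Let_def)

context tree
begin

text \<open>The fork of the two paths is visible in the ports alone: it is where the sequences from
  \<open>c\<close> first differ. Hence nodes with matching sequences from two roots also have
  matching sequences between each other, which moves the comparison from \<open>a\<close> and
  \<open>b\<close> to other nodes.\<close>

lemma seq_between:
  assumes "c \<in> N" "u \<in> N" "w \<in> N"
  shows "seq T u w = (let k = length (longest_common_prefix (seq T c u) (seq T c w))
    in rev (drop k (seq T c u)) @ drop k (seq T c w))"
proof -
  obtain R m P Q where f: "path c u = R @ m # P" "path c w = R @ m # Q" "path u w = rev P @ m # Q"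
    "P \<noteq> [] \<Longrightarrow> Q \<noteq> [] \<Longrightarrow> hd P \<noteq> hd Q"
    by (rule path_fork[OF assms]) blast
  have m: "m \<in> N" using on_path_nodes[OF assms(1,2)] f(1) by simp
  have mu: "path m u = m # P" "path m w = m # Q"
    using path_append(2)[OF assms(1,2) f(1)] path_append(2)[OF assms(1,3) f(2)] by auto
  let ?X = "all_ports T (R @ [m])" and ?S = "all_ports T (m # P)" and ?S' = "all_ports T (m # Q)"
  have s: "seq T c u = ?X @ ?S" "seq T c w = ?X @ ?S'"
    using f(1,2) by (simp_all add: seq_def all_ports_append[of T R m P] all_ports_append[of T R m Q])
  \<comment> \<open>After the fork the next nodes differ, so the very first ports do; the common
    prefix stops exactly at \<open>m\<close>.\<close>
  have "longest_common_prefix ?S ?S' = []"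
  proof (rule longest_common_prefix_Nil)
    assume ne: "?S \<noteq> []" "?S' \<noteq> []"
    then obtain x P' y Q' where PQ: "P = x # P'" "Q = y # Q'" by (cases P; cases Q) auto
    then have "adj m x" "adj m y"
      using path_props(1)[OF m assms(2)] path_props(1)[OF m assms(3)] mu by (auto simp: simple_path_def)
    then have "port T m x \<noteq> port T m y" using port_inj f(4) PQ by auto
    then show "hd ?S \<noteq> hd ?S'" using PQ by simp
  qed
  then have "longest_common_prefix (seq T c u) (seq T c w) = ?X"
    by (simp add: s longest_common_prefix_append)
  moreover have "seq T u w = rev ?S @ ?S'"
    using f(3) all_ports_rev[of T "m # P"] by (simp add: seq_def all_ports_append[of T "rev P" m Q])
  ultimately show ?thesis by (simp add: s Let_def)
qed

lemma seq_extension: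
  assumes "c \<in> N" "w \<in> N" "y \<in> N" and y: "seq T c y = seq T c w @ [q, q']"
  shows "adj w y" "q = port T w y" "q' = port T y w"
proof -
  have d: "d c y = Suc (d c w)" using y length_seq[of c y] length_seq[of c w] by simp
  define z where "z = path c y ! d c w"
  have z: "z \<in> N" "seq T c z = take (2 * d c w) (seq T c y)"
    using node_at_dist(1)[OF assms(1,3), of "d c w"] seq_take[OF assms(1,3), of "d c w"] d by (simp_all add: z_def)
  then have "seq T c z = seq T c w" using y by (simp add: length_seq)
  then have zw: "z = w" using seq_inj assms(1,2) z(1) by blast
  have last: "path c y ! Suc (d c w) = y" using path_nth[OF assms(1,3) path_props(6)[OF assms(1,3)]] d by simp
  have *: "adj w y" "path c y = path c w @ [y]"
    using path_next[OF assms(1,3), of "d c w"] d zw last by (simp_all add: z_def)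
  then show "adj w y" by simp
  show "q = port T w y" "q' = port T y w" using seq_step[OF assms(1) *] y by simp_all
qed

lemma alike_step:
  assumes "u \<in> N" "w \<in> N" "adj x y" "path u y = path u x @ [y]" "x' \<in> N" "y' \<in> N"
    "seq T u x = seq T w x'" "seq T u y = seq T w y'"
  shows "adj x' y'" "port T x' y' = port T x y" "port T y' x' = port T y x"
  using seq_extension[OF assms(2,5,6), of "port T x y" "port T y x"] seq_step[OF assms(1,3,4)] assms(7,8)
  by simp_all

lemma view_edges:
  assumes "v \<in> N" "e \<in> edges (view T v r)"
  obtains x y where "adj x y" "d v x \<le> r" "d v y \<le> r" "path v y = path v x @ [y]"
    "e = {out_ports T (path v x), out_ports T (path v y)}"
proof -
  interpret L: ball_view T v r "local_view T v r" id by (rule ball_view_local[OF assms(1)])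
  define f0 where "f0 = (\<lambda>w. out_ports (local_view T v r) (tpath (local_view T v r) (vroot (local_view T v r)) w))"
  have f0: "f0 w = out_ports T (path v w)" if "w \<in> L.B" for w
    using L.out_ports_V[OF L.root_B that] L.root_V by (simp add: f0_def)
  obtain e' where e': "e' \<in> edges T" "e' \<subseteq> L.B" "e = f0 ` e'"
    using assms(2) by (auto simp: view_def anon_def Let_def local_view_def L.B_def f0_def)
  have "card e' = 2" using e'(1) port_tree by (auto simp: port_tree_def)
  then obtain x y where xy: "e' = {x, y}" by (auto simp: card_2_iff)
  then have adj: "adj x y" "adj y x" using e'(1) adj_commute by auto
  have B: "x \<in> L.B" "y \<in> L.B" using e' xy by auto
  have e: "e = {out_ports T (path v x), out_ports T (path v y)}" using e'(3) xy f0 B by simp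
  then have "e = {out_ports T (path v y), out_ports T (path v x)}" by blast
  then show ?thesis
    using path_step[OF assms(1) adj(1)] e that[of x y] that[of y x] adj B by (auto simp: L.B_def)
qed

text \<open>The name of a node in an anonymised view depends only on its sequence from the root, so
  the partner \<open>y\<close> of \<open>x\<close> carries the same name. These inclusions become
  equalities once \<open>u\<close> and \<open>w\<close> are exchanged.\<close>

lemma view_part:
  assumes u: "u \<in> N" and w: "w \<in> N"
    and alike: "\<And>x. x \<in> N \<Longrightarrow> d u x \<le> r \<Longrightarrow> \<exists>y\<in>N. seq T u x = seq T w y \<and> degree T x = degree T y"
  shows "nodes (view T u r) \<subseteq> nodes (view T w r)" "edges (view T u r) \<subseteq> edges (view T w r)"
    "\<And>X Y. {X, Y} \<in> edges (view T u r) \<Longrightarrow> port (view T u r) X Y = port (view T w r) X Y"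
    "\<And>X. X \<in> nodes (view T u r) \<Longrightarrow> vdeg (view T u r) X = vdeg (view T w r) X"
proof -
  interpret U: ball_view T u r "view T u r" "\<lambda>x. out_ports T (path u x)" by (rule ball_view_view[OF u])
  interpret W: ball_view T w r "view T w r" "\<lambda>x. out_ports T (path w x)" by (rule ball_view_view[OF w])
  have alike': "\<exists>y\<in>W.B. seq T u x = seq T w y \<and> degree T x = degree T y \<and> out_ports T (path u x) = out_ports T (path w y)"
    if x: "x \<in> U.B" for x
  proof -
    obtain y where y: "y \<in> N" "seq T u x = seq T w y" "degree T x = degree T y"
      using alike x unfolding U.B_def by blast
    have "out_ports T (path u x) = out_ports T (path w y)" using y(2) by (simp add: out_ports_conv seq_def)
    moreover have "d w y = d u x" using length_seq[of u x] length_seq[of w y] y(2) by simp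
    ultimately show ?thesis using x y by (auto simp: U.B_def W.B_def)
  qed
  show "nodes (view T u r) \<subseteq> nodes (view T w r)"
  proof
    fix X assume "X \<in> nodes (view T u r)"
    then obtain x where "x \<in> U.B" "X = out_ports T (path u x)" unfolding U.nodes_V U.B_def by blast
    then show "X \<in> nodes (view T w r)" using alike'[of x] W.nodes_V by (auto simp: W.B_def)
  qed
  show "vdeg (view T u r) X = vdeg (view T w r) X" if X: "X \<in> nodes (view T u r)" for X
  proof -
    obtain x where x: "x \<in> U.B" "X = out_ports T (path u x)" using X unfolding U.nodes_V U.B_def by blast
    obtain y where y: "y \<in> W.B" "degree T x = degree T y" "X = out_ports T (path w y)" using alike'[OF x(1)] x(2) by auto
    show ?thesis using U.degree_V[of x] W.degree_V[of y] x y by (simp add: U.B_def W.B_def)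
  qed
  have *: "e \<in> edges (view T w r) \<and> (\<forall>X Y. e = {X, Y} \<longrightarrow> port (view T u r) X Y = port (view T w r) X Y)"
    if e: "e \<in> edges (view T u r)" for e
  proof -
    obtain x y where xy: "adj x y" "d u x \<le> r" "d u y \<le> r" "path u y = path u x @ [y]"
      "e = {out_ports T (path u x), out_ports T (path u y)}"
      using view_edges[OF u e] .
    have yx: "adj y x" using xy(1) adj_commute by blast
    have "x \<in> U.B" "y \<in> U.B" using xy adj_nodes[OF xy(1)] by (auto simp: U.B_def)
    then obtain x' y' where x': "x' \<in> W.B" "seq T u x = seq T w x'" "out_ports T (path u x) = out_ports T (path w x')"
      and y': "y' \<in> W.B" "seq T u y = seq T w y'" "out_ports T (path u y) = out_ports T (path w y')"
      using alike' by metis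
    note st = alike_step[OF u w xy(1,4) W.B_nodes[OF x'(1)] W.B_nodes[OF y'(1)] x'(2) y'(2)]
    have yx': "adj y' x'" using st(1) adj_commute by blast
    have B: "d w x' \<le> r" "d w y' \<le> r" "x' \<in> N" "y' \<in> N" using x'(1) y'(1) by (auto simp: W.B_def)
    have "e \<in> edges (view T w r)"
      using W.edges_V[OF B(3,4,1,2)] st(1) xy(5) x'(3) y'(3) by simp
    moreover have "port (view T u r) (out_ports T (path u x)) (out_ports T (path u y)) =
        port (view T w r) (out_ports T (path u x)) (out_ports T (path u y))"
      using U.port_V[OF xy(1-3)] W.port_V[OF st(1) B(1,2)] st(2) x'(3) y'(3) by simp
    moreover have "port (view T u r) (out_ports T (path u y)) (out_ports T (path u x)) =
        port (view T w r) (out_ports T (path u y)) (out_ports T (path u x))"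
      using U.port_V[OF yx xy(3,2)] W.port_V[OF yx' B(2,1)] st(3) x'(3) y'(3) by simp
    ultimately show ?thesis using xy(5) by (auto simp: doubleton_eq_iff)
  qed
  show "edges (view T u r) \<subseteq> edges (view T w r)" using * by blast
  show "port (view T u r) X Y = port (view T w r) X Y" if "{X, Y} \<in> edges (view T u r)" for X Y
    using *[OF that] by blast
qed

lemma view_eqI:
  assumes u: "u \<in> N" and w: "w \<in> N"
    and alike: "\<And>x. x \<in> N \<Longrightarrow> d u x \<le> r \<Longrightarrow> \<exists>y\<in>N. seq T u x = seq T w y \<and> degree T x = degree T y"
      "\<And>x. x \<in> N \<Longrightarrow> d w x \<le> r \<Longrightarrow> \<exists>y\<in>N. seq T w x = seq T u y \<and> degree T x = degree T y"
  shows "view T u r = view T w r"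
proof -
  note p = view_part[OF u w alike(1)] and q = view_part[OF w u alike(2)]
  have n: "nodes (view T u r) = nodes (view T w r)" using p(1) q(1) by blast
  have e: "edges (view T u r) = edges (view T w r)" using p(2) q(2) by blast
  have "port (view T u r) X Y = port (view T w r) X Y" for X Y
    using p(3)[where X = X and Y = Y] anon_outside(1)[where x = X and y = Y] e unfolding view_def by metis
  moreover have "vdeg (view T u r) X = vdeg (view T w r) X" for X
    using p(4)[where X = X] anon_outside(2)[where x = X] n unfolding view_def by metis
  moreover have "vroot (view T u r) = vroot (view T w r)"
    using ball_view.root_V[OF ball_view_view[OF u]] ball_view.root_V[OF ball_view_view[OF w]] u w by simp
  ultimately show ?thesis using n e by (intro pview.equality) auto
qed

text \<open>The radius makes both views cover the tree. Naming nodes from \<open>u\<close> and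
  undoing the naming from \<open>w\<close> is an automorphism, hence the identity; so
  \<open>u\<close> has the empty name from \<open>w\<close> as well.\<close>

lemma view_determines_root:
  assumes sym: "nonsymmetric T" and u: "u \<in> N" and w: "w \<in> N" and r: "diameter T \<le> r"
    and eq: "view T u r = view T w r"
  shows "u = w"
proof -
  let ?f = "\<lambda>x. out_ports T (path u x)" and ?g = "\<lambda>x. out_ports T (path w x)"
  interpret U: ball_view T u r "view T w r" ?f using ball_view_view[OF u, of r] eq by simp
  interpret W: ball_view T w r "view T w r" ?g by (rule ball_view_view[OF w])
  have le: "d v x \<le> r" if "v \<in> N" "x \<in> N" for v x using dist_le_diameter[OF that] r by simp
  have BN: "U.B = N" "W.B = N" using le u w by (auto simp: U.B_def W.B_def)
  have bij: "bij_betw ?f N (nodes (view T w r))" "bij_betw ?g N (nodes (view T w r))"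
    using U.inj_B W.inj_B U.nodes_V W.nodes_V BN by (auto simp: bij_betw_def U.B_def W.B_def)
  define \<phi> where "\<phi> = inv_into N ?g \<circ> ?f"
  have \<phi>: "bij_betw \<phi> N N" unfolding \<phi>_def using bij bij_betw_trans bij_betw_inv_into by blast
  have g\<phi>: "?g (\<phi> x) = ?f x" if "x \<in> N" for x
  proof -
    have "?f x \<in> ?g ` N" using bij that by (simp add: bij_betw_def) blast
    then show ?thesis unfolding \<phi>_def comp_def by (rule f_inv_into_f)
  qed
  have \<phi>N: "\<phi> x \<in> N" if "x \<in> N" for x using \<phi> that by (auto simp: bij_betw_def)
  have "adj (\<phi> x) (\<phi> y) \<longleftrightarrow> adj x y" if "x \<in> N" "y \<in> N" for x y
    using W.edges_V[of "\<phi> x" "\<phi> y"] U.edges_V[of x y] that \<phi>N le u w g\<phi> by simp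
  moreover have "port T (\<phi> x) (\<phi> y) = port T x y" if "x \<in> N" "y \<in> N" "adj x y" for x y
    using W.port_V[of "\<phi> x" "\<phi> y"] U.port_V[of x y] that \<phi>N le u w g\<phi> calculation by simp
  ultimately have "automorphism T \<phi>" using \<phi> by (simp add: automorphism_def)
  then have "\<phi> u = u" using sym u by (simp add: nonsymmetric_def)
  then have "?g u = ?f u" using g\<phi>[OF u] by simp
  also have "\<dots> = ?g w" using u w by simp
  finally show ?thesis using out_ports_inj[OF w u w] by simp
qed

text \<open>\<open>xi\<close> is a \<open>LEAST\<close>, so some feasible time must be exhibited.
  With radius \<open>diameter T\<close> each node recognises itself on the map and outputs its path
  to a fixed node.\<close>

lemma feasible_xi:
  assumes "nonsymmetric T"
  shows "feasible_with_map T (xi T)"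
proof -
  obtain l where l: "l \<in> N" using nodes_ne by blast
  define alg where "alg V = out_ports T (path (SOME v. v \<in> N \<and> view T v (diameter T) = V) l)" for V
  have "out_ports T (path v l) = alg (view T v (diameter T))" if v: "v \<in> N" for v
  proof -
    have "(SOME x. x \<in> N \<and> view T x (diameter T) = view T v (diameter T)) = v"
      using view_determines_root[OF assms _ v] v by (intro some_equality) auto
    then show ?thesis by (simp add: alg_def)
  qed
  then have "leader_election T (\<lambda>v. alg (view T v (diameter T)))"
    unfolding leader_election_def using path_between_iff l by metis
  then show ?thesis unfolding xi_def feasible_with_map_def by (intro LeastI) blast
qed

end

text \<open>Equal outputs place the leader at equal distances from \<open>u\<close> and
  \<open>w\<close>. But the node on the other side must cross the central edge in addition to the
  common distance to its own end, and is strictly further.\<close>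

lemma (in central_tree) opposite_views_differ:
  assumes u: "u \<in> side a b" and w: "w \<in> side b a" and eq: "d u a = d w b" and feas: "feasible_with_map T r"
  shows "view T u r \<noteq> view T w r"
proof
  assume view: "view T u r = view T w r"
  have n: "u \<in> N" "w \<in> N" using u w side_nodes by auto
  obtain alg where "leader_election T (\<lambda>v. alg (view T v r))" using feas by (auto simp: feasible_with_map_def)
  then obtain l where l: "l \<in> N" "\<And>v. v \<in> N \<Longrightarrow> \<exists>xs. path_between T v l xs \<and> out_ports T xs = alg (view T v r)"
    by (auto simp: leader_election_def)
  have "out_ports T (path v l) = alg (view T v r)" if "v \<in> N" for v
    using l(2)[OF that] path_eqI by blast
  then have "out_ports T (path u l) = out_ports T (path w l)" using n view by simp
  then have dl: "d u l = d w l" using length_out_ports[of T "path u l"] length_out_ports[of T "path w l"] by (simp add: tdist_def)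
  show False
  proof (cases "l \<in> side a b")
    case True
    then show False
      using cross(2)[OF adj_ba w True] dist_triangle[OF n(1) ab_nodes(1) l(1)] dl eq by simp
  next
    case False
    then have lb: "l \<in> side b a" using sides l(1) by blast
    show False using cross(2)[OF adj_ab u lb] dist_triangle[OF n(2) ab_nodes(2) l(1)] dl eq by simp
  qed
qed

section \<open>Existence of the advice\<close>

context tree
begin

lemma path_head:
  assumes "c \<in> N" "x \<in> N" "c \<noteq> x"
  obtains y ys where "path c x = c # y # ys" "adj c y" "hd (seq T c x) = port T c y"
proof -
  have "d c x \<noteq> 0" using dist_eq_0 assms by simp
  then have "length (path c x) \<ge> 2" using length_path assms by simp
  then obtain c' y ys where p: "path c x = c' # y # ys" by (cases "path c x" rule: remdups_adj.cases) auto
  moreover have "c' = c" using path_props(2)[OF assms(1,2)] p by simp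
  moreover have "adj c y" using path_props(1)[OF assms(1,2)] p \<open>c' = c\<close> by (simp add: simple_path_def)
  ultimately show ?thesis using that by (simp add: seq_def)
qed

text \<open>Distances add up exactly when the fork is \<open>c\<close> itself, that is, when the two
  paths leave \<open>c\<close> by different ports.\<close>

lemma diverge_iff:
  assumes "c \<in> N" "u \<in> N" "w \<in> N" "c \<noteq> u" "c \<noteq> w"
  shows "hd (seq T c u) \<noteq> hd (seq T c w) \<longleftrightarrow> d u w = d c u + d c w"
proof -
  obtain R m P Q where f: "path c u = R @ m # P" "path c w = R @ m # Q" "path u w = rev P @ m # Q"
    "P \<noteq> [] \<Longrightarrow> Q \<noteq> [] \<Longrightarrow> hd P \<noteq> hd Q"
    by (rule path_fork[OF assms(1-3)]) blast
  obtain y ys where y: "path c u = c # y # ys" "adj c y" "hd (seq T c u) = port T c y"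
    by (rule path_head[OF assms(1,2,4)])
  obtain z zs where z: "path c w = c # z # zs" "adj c z" "hd (seq T c w) = port T c z"
    by (rule path_head[OF assms(1,3,5)])
  have dist: "d u w = length P + length Q" "d c u = length R + length P" "d c w = length R + length Q"
    using f(1-3) by (simp_all add: tdist_def)
  show ?thesis
  proof (cases R)
    case Nil
    then have "y \<noteq> z" using f y z by auto
    then show ?thesis using y z port_inj dist Nil by auto
  next
    case (Cons r R')
    then have "y = z" using f(1,2) y(1) z(1) by (cases R') auto
    then show ?thesis using y z dist Cons by simp
  qed
qed

end

section \<open>Recovering ports, degrees and views from the lists\<close>

context central_tree
begin

lemma seq_cross:
  assumes "w \<in> side b a"
  shows "seq T a w = port T a b # port T b a # seq T b w"
proof -
  have "path a w = a # path b w" using cross(1)[OF adj_ab side_self[OF adj_ab] assms] ab_nodes by simp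
  moreover obtain ys where "path b w = b # ys"
    using path_props(2,4)[OF ab_nodes(2) side_nodes[OF assms]] by (metis list.collapse)
  ultimately show ?thesis by (simp add: seq_def)
qed

lemma side_iff_hd:
  assumes "x \<in> N" "x \<noteq> a"
  shows "x \<in> side a b \<longleftrightarrow> hd (seq T a x) \<noteq> port T a b"
proof
  assume x: "x \<in> side a b"
  obtain y ys where y: "path a x = a # y # ys" "adj a y" "hd (seq T a x) = port T a y"
    using path_head[OF ab_nodes(1) assms(1)] assms(2) by metis
  have "y \<noteq> b" using same_side_edge(2)[OF adj_ab side_self[OF adj_ab] x] y(1) by auto
  then show "hd (seq T a x) \<noteq> port T a b" using y port_inj adj_ab by metis
next
  assume "hd (seq T a x) \<noteq> port T a b"
  then show "x \<in> side a b" using seq_cross[of x] sides[OF assms(1)] by auto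
qed

lemma codes_separated:
  assumes "separated T"
  shows "codes a = {seq T a w |w. w \<in> side a b}"
proof -
  have "w \<in> N \<and> {a, b} \<notin> path_edges (path a w) \<longleftrightarrow> w \<in> side a b" for w
    using edge_on_path_iff[OF adj_ab side_self[OF adj_ab]] side_nodes sides side_disjoint by blast
  then show ?thesis unfolding codes_eq using assms by simp
qed

text \<open>Every port of \<open>w\<close> either leads to a deeper node of its side, and so shows
  up in a longer code, or is the one towards \<open>a\<close>; at \<open>a\<close> itself the
  exception is the central port. Degrees are thus determined by the list.\<close>

lemma degree_separated:
  assumes sep: "separated T" and w: "w \<in> side a b"
  shows "{..<degree T w} = insert (if w = a then port T a b else last (seq T a w)) {q. \<exists>q'. seq T a w @ [q, q'] \<in> codes a}"
    (is "_ = insert ?l ?Q")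
proof (intro equalityI subsetI)
  have wn: "w \<in> N" using w side_nodes by blast
  fix q assume "q \<in> {..<degree T w}"
  then obtain y where y: "adj w y" "port T w y = q" using port_surj[OF wn] by auto
  have yn: "y \<in> N" using adj_nodes y by blast
  show "q \<in> insert ?l ?Q"
  proof (cases "path a y = path a w @ [y]")
    case False
    then show ?thesis using port_forward[OF ab_nodes(1) wn y(1)] y(2) by simp
  next
    case True
    show ?thesis
    proof (cases "y \<in> side a b")
      case True
      then have "seq T a w @ [q, port T y w] \<in> codes a"
        using seq_step[OF ab_nodes(1) y(1) \<open>path a y = _\<close>] y(2) codes_separated[OF sep] by auto
      then show ?thesis by blast
    next
      case False
      then show ?thesis using adj_across[OF adj_ab y(1) w] sides yn y(2) by auto
    qed
  qed
next
  have wn: "w \<in> N" using w side_nodes by blast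
  fix q assume "q \<in> insert ?l ?Q"
  then consider "w = a" "q = port T a b" | "w \<noteq> a" "q = last (seq T a w)" | "q \<in> ?Q" by (auto split: if_splits)
  then show "q \<in> {..<degree T w}"
  proof cases
    case 1
    then show ?thesis using port_less[OF adj_ab] by simp
  next
    case 2
    obtain u where u: "adj u w" "path a w = path a u @ [w]"
      using path_last_step[OF ab_nodes(1) wn] 2(1) by metis
    then show ?thesis using seq_step[OF ab_nodes(1) u] port_less[of w u] adj_commute[of u w] 2(2) by simp
  next
    case 3
    then obtain q' where "seq T a w @ [q, q'] \<in> codes a" by blast
    then obtain y where y: "y \<in> side a b" "seq T a w @ [q, q'] = seq T a y"
      unfolding codes_separated[OF sep] by auto
    then show ?thesis
      using seq_extension[OF ab_nodes(1) wn side_nodes[OF y(1)] y(2)[symmetric]] port_less by simp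
  qed
qed

lemma central_port_fresh:
  assumes sep: "separated T"
  shows "[port T a b, q'] \<notin> codes a"
proof
  assume "[port T a b, q'] \<in> codes a"
  then obtain y where y: "y \<in> side a b" "[port T a b, q'] = seq T a y"
    unfolding codes_separated[OF sep] by auto
  then have "y \<noteq> a" using ab_nodes by auto
  moreover have "hd (seq T a y) = port T a b" by (simp flip: y(2))
  ultimately show False using side_iff_hd[OF side_nodes[OF y(1)]] y(1) by simp
qed

text \<open>The central port is the only port of \<open>a\<close> that starts no code, so the list
  determines the degree of \<open>a\<close> and this port.\<close>

lemma degree_central_separated:
  assumes sep: "separated T"
  shows "degree T a = Suc (card {q. \<exists>q'. [q, q'] \<in> codes a})"
    "port T a b \<notin> {q. \<exists>q'. [q, q'] \<in> codes a}"
    "{..<degree T a} = insert (port T a b) {q. \<exists>q'. [q, q'] \<in> codes a}"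
proof -
  show *: "{..<degree T a} = insert (port T a b) {q. \<exists>q'. [q, q'] \<in> codes a}"
    using degree_separated[OF sep side_self[OF adj_ab]] ab_nodes by simp
  show **: "port T a b \<notin> {q. \<exists>q'. [q, q'] \<in> codes a}" using central_port_fresh[OF sep] by simp
  have "finite {q. \<exists>q'. [q, q'] \<in> codes a}" using * by (metis finite_insert finite_lessThan)
  then show "degree T a = Suc (card {q. \<exists>q'. [q, q'] \<in> codes a})"
    using ** arg_cong[OF *, of card] by simp
qed

lemma separated_same_degree:
  assumes sep: "separated T" and eq: "codes a = codes b"
    and x: "x \<in> side a b" and y: "y \<in> side b a" and s: "seq T a x = seq T b y"
  shows "degree T x = degree T y"
proof -
  interpret S: central_tree T b a h by (rule swap)
  have len: "d a x = d b y" using s length_seq[of a x] length_seq[of b y] by simp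
  have "x = a \<longleftrightarrow> y = b"
    using len dist_eq_0[OF ab_nodes(1) side_nodes[OF x]] dist_eq_0[OF ab_nodes(2) side_nodes[OF y]] by auto
  then consider "x = a" "y = b" | "x \<noteq> a" "y \<noteq> b" by blast
  then show ?thesis
  proof cases
    case 1
    then show ?thesis using degree_central_separated(1)[OF sep] S.degree_central_separated(1)[OF sep] eq by simp
  next
    case 2
    then have "{..<degree T x} = {..<degree T y}"
      using degree_separated[OF sep x] S.degree_separated[OF sep y] s eq by simp
    then show ?thesis by (metis card_lessThan)
  qed
qed

text \<open>Equal codes match each side with the other. A sequence from \<open>a\<close> to a node
  across is the pair of central ports followed by a code of \<open>b\<close>, so these ports must be
  shown equal too.\<close>

lemma separated_alike:
  assumes sep: "separated T" and eq: "codes a = codes b" and x: "x \<in> N"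
  shows "\<exists>y\<in>N. seq T a x = seq T b y \<and> degree T x = degree T y"
proof -
  interpret S: central_tree T b a h by (rule swap)
  show ?thesis
  proof (cases "x \<in> side a b")
    case True
    then have "seq T a x \<in> codes b" using codes_separated[OF sep] eq by auto
    then obtain y where y: "y \<in> side b a" "seq T a x = seq T b y" using S.codes_separated[OF sep] by auto
    then show ?thesis using separated_same_degree[OF sep eq True] side_nodes by blast
  next
    case False
    then have xb: "x \<in> side b a" using sides x by blast
    then have "seq T b x \<in> codes a" using S.codes_separated[OF sep] eq by auto
    then obtain y where y: "y \<in> side a b" "seq T b x = seq T a y" using codes_separated[OF sep] by auto
    \<comment> \<open>With equal degrees, both central ports are the one port missing among the
      first entries of the same set of codes.\<close>
    have "degree T a = degree T b"
      using degree_central_separated(1)[OF sep] S.degree_central_separated(1)[OF sep] eq by simp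
    then have "{..<degree T a} = insert (port T b a) {q. \<exists>q'. [q, q'] \<in> codes a}"
      using S.degree_central_separated(3)[OF sep] eq by metis
    then have "port T a b \<in> insert (port T b a) {q. \<exists>q'. [q, q'] \<in> codes a}"
      using port_less[OF adj_ab] by (metis lessThan_iff)
    then have "port T a b = port T b a" using degree_central_separated(2)[OF sep] by blast
    then have "seq T a x = seq T b y" using seq_cross[OF xb] S.seq_cross[OF y(1)] y(2) by simp
    moreover have "degree T x = degree T y"
      using separated_same_degree[OF sep eq y(1) xb] y(2) by simp
    ultimately show ?thesis using y side_nodes by blast
  qed
qed

lemma codes_differ_separated:
  assumes sep: "separated T" and feas: "feasible_with_map T r"
  shows "codes a \<noteq> codes b"
proof
  interpret S: central_tree T b a h by (rule swap)
  assume eq: "codes a = codes b"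
  have "view T a r = view T b r"
    using separated_alike[OF sep eq] S.separated_alike[OF sep eq[symmetric]] by (intro view_eqI ab_nodes)
  then show False
    using opposite_views_differ[OF side_self[OF adj_ab] side_self[OF adj_ba] _ feas] ab_nodes by simp
qed

text \<open>For a node nearer than \<open>h\<close>, its sequence with one further port still fits
  into length \<open>2 * h - 1\<close>. All its ports but the incoming one are therefore visible in
  the codes.\<close>

lemma degree_not_separated:
  assumes sep: "\<not> separated T" and c: "c \<in> N" and x: "x \<in> N" and le: "d c x < h"
  shows "{..<degree T x} = (if x = c then {} else {last (seq T c x)}) \<union> {q. seq T c x @ [q] \<in> codes c}"
    (is "_ = ?l \<union> ?Q")
proof -
  have "length (seq T c x @ [q]) \<le> 2 * h - 1" for q using le by (simp add: length_seq)
  then have Q: "q \<in> ?Q \<longleftrightarrow> (\<exists>w\<in>N. prefix (seq T c x @ [q]) (seq T c w))" for q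
    using sep unfolding codes_eq by simp
  have "q \<in> ?Q \<longleftrightarrow> q < degree T x \<and> (x = c \<or> q \<noteq> last (seq T c x))" for q
    unfolding Q prefix_seq_iff[OF c]
  proof
    assume "\<exists>y\<in>N. seq T c x @ [q] = seq T c y \<or>
      (\<exists>q'<degree T y. (y = c \<or> q' \<noteq> last (seq T c y)) \<and> seq T c x @ [q] = seq T c y @ [q'])"
    then obtain y where y: "y \<in> N" "seq T c x @ [q] = seq T c y \<or>
      (\<exists>q'<degree T y. (y = c \<or> q' \<noteq> last (seq T c y)) \<and> seq T c x @ [q] = seq T c y @ [q'])" by blast
    \<comment> \<open>Full sequences have even length, so this extension can only be of the odd
      kind.\<close>
    have "seq T c x @ [q] \<noteq> seq T c y"
    proof
      assume "seq T c x @ [q] = seq T c y"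
      then have "Suc (2 * d c x) = 2 * d c y" using length_seq[of c x] length_seq[of c y]
        by (metis length_append_singleton)
      then show False by presburger
    qed
    then have "q < degree T y \<and> (y = c \<or> q \<noteq> last (seq T c y))" "seq T c x = seq T c y" using y(2) by auto
    moreover have "x = y" using seq_inj[OF c x y(1)] calculation(2) .
    ultimately show "q < degree T x \<and> (x = c \<or> q \<noteq> last (seq T c x))" by simp
  next
    assume "q < degree T x \<and> (x = c \<or> q \<noteq> last (seq T c x))"
    then show "\<exists>y\<in>N. seq T c x @ [q] = seq T c y \<or>
      (\<exists>q'<degree T y. (y = c \<or> q' \<noteq> last (seq T c y)) \<and> seq T c x @ [q] = seq T c y @ [q'])"
      using x by blast
  qed
  moreover have "last (seq T c x) < degree T x" if xc: "x \<noteq> c"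
  proof -
    obtain u where u: "adj u x" "path c x = path c u @ [x]" using path_last_step[OF c x] xc by metis
    then show ?thesis using seq_step[OF c u] port_less[of x u] adj_commute[of u x] by simp
  qed
  ultimately show ?thesis by auto
qed

lemma take_codes:
  assumes "\<not> separated T" "c \<in> N" "x \<in> N"
  shows "take (2 * h - 1) (seq T c x) \<in> codes c"
  using assms take_is_prefix[of "2 * h - 1" "seq T c x"] unfolding codes_eq by auto

text \<open>A node at depth \<open>h\<close> is a leaf, so its only port is 0. Truncation to
  \<open>2 * h - 1\<close> removes just this port, and nothing is lost.\<close>

lemma leaf_seq:
  assumes x: "x \<in> side a b" "d a x = h"
  shows "degree T x = 1" "seq T a x = take (2 * h - 1) (seq T a x) @ [0]"
proof -
  interpret S: central_tree T b a h by (rule swap)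
  show *: "degree T x = 1" using S.deep_leaf[OF x] .
  have n: "x \<in> N" "a \<noteq> x" using side_nodes x h_pos ab_nodes by auto
  obtain u where u: "adj u x" "path a x = path a u @ [x]" using path_last_step[OF ab_nodes(1) n] .
  then have "port T x u = 0" using port_less[of x u] adj_commute[of u x] * by simp
  then have s: "seq T a x = (seq T a u @ [port T u x]) @ [0]" using seq_step[OF ab_nodes(1) u] by simp
  moreover have "2 * h - 1 = length (seq T a u @ [port T u x])"
    using length_seq[of a x] x s by simp
  ultimately show "seq T a x = take (2 * h - 1) (seq T a x) @ [0]" by simp
qed

text \<open>A code of maximal length describes a path with at least \<open>h\<close> edges. As it
  does not start with the central port, its node at distance \<open>h\<close> is a deepest leaf on
  the side of \<open>a\<close>.\<close>

lemma branch:
  assumes sep: "\<not> separated T" and s: "s \<in> codes a" "length s = 2 * h - 1" "hd s \<noteq> port T a b"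
  obtains v where "v \<in> side a b" "d v a = h" "d a v = h" "seq T a v = s @ [0]" "hd (seq T a v) = hd s"
proof -
  obtain w where w: "w \<in> N" "prefix s (seq T a w)" using s(1) sep by (auto simp: codes_eq)
  have "h \<le> d a w" using prefix_length_le[OF w(2)] s(2) h_pos by (simp add: length_seq)
  define v where "v = path a w ! h"
  have v: "v \<in> N" "d a v = h" "seq T a v = take (2 * h) (seq T a w)"
    using node_at_dist(1,3)[OF ab_nodes(1) w(1) \<open>h \<le> d a w\<close>] seq_take[OF ab_nodes(1) w(1) \<open>h \<le> d a w\<close>]
    by (simp_all add: v_def)
  have "s = take (length s) (seq T a w)" using w(2) by (metis append_eq_conv_conj prefixE)
  then have st: "s = take (2 * h - 1) (seq T a v)" using v(3) s(2) by (simp add: min_def)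
  then have hd: "hd (seq T a v) = hd s" using h_pos by (simp add: hd_take)
  have "v \<noteq> a" using v h_pos ab_nodes by auto
  then have vs: "v \<in> side a b" using side_iff_hd[OF v(1)] hd s(3) by simp
  show ?thesis
    using that[OF vs] v(2) leaf_seq(2)[OF vs v(2)] st hd dist_commute[OF v(1) ab_nodes(1)] by simp
qed

text \<open>Nodes nearer to \<open>a\<close> than \<open>h\<close> are matched through their codes,
  and visible nodes further away through \<open>branch\<close>. \<open>seq_between\<close> then
  turns matching sequences from \<open>a\<close> and \<open>b\<close> into matching ones from
  \<open>v\<close> and \<open>w\<close>.\<close>

lemma not_separated_alike:
  assumes sep: "\<not> separated T" and eq: "codes a = codes b"
    and v: "v \<in> side a b" "d a v = h" and w: "w \<in> side b a" and vw: "seq T a v = seq T b w"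
    and p: "hd (seq T a v) \<noteq> port T a b" "hd (seq T a v) \<noteq> port T b a"
    and x: "x \<in> N" "d v x \<le> 2 * h - 1"
  shows "\<exists>y\<in>N. seq T v x = seq T w y \<and> degree T x = degree T y"
proof -
  interpret S: central_tree T b a h by (rule swap)
  have n: "v \<in> N" "w \<in> N" using v w side_nodes by auto
  have "\<exists>y\<in>N. seq T a x = seq T b y \<and> degree T x = degree T y"
  proof (cases "d a x < h")
    case True
    then have "take (2 * h - 1) (seq T a x) = seq T a x" by (simp add: length_seq)
    then have "seq T a x \<in> codes b" using take_codes[OF sep ab_nodes(1) x(1)] eq by simp
    then obtain y' where y': "y' \<in> N" "prefix (seq T a x) (seq T b y')" using sep by (auto simp: codes_eq)
    have le: "d a x \<le> d b y'" using prefix_length_le[OF y'(2)] by (simp add: length_seq)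
    define y where "y = path b y' ! d a x"
    have y: "y \<in> N" "d b y = d a x" "seq T b y = take (2 * d a x) (seq T b y')"
      using node_at_dist(1,3)[OF ab_nodes(2) y'(1) le] seq_take[OF ab_nodes(2) y'(1) le] by (simp_all add: y_def)
    have sy: "seq T a x = seq T b y"
      using y(3) y'(2) length_seq[of a x] by (metis append_eq_conv_conj prefixE)
    have "x = a \<longleftrightarrow> y = b" using y dist_eq_0[OF ab_nodes(1) x(1)] dist_eq_0[OF ab_nodes(2) y(1)] by auto
    then have "{..<degree T x} = {..<degree T y}"
      using degree_not_separated[OF sep ab_nodes(1) x(1) True] y(2) True sy eq
        degree_not_separated[OF sep ab_nodes(2) y(1)] by simp
    then have "degree T x = degree T y" by (metis card_lessThan)
    then show ?thesis using sy y by blast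
  next
    case False
    have xa: "a \<noteq> x" "a \<noteq> v" using False h_pos v(2) ab_nodes by auto
    \<comment> \<open>The right-hand side is at least \<open>2 * h\<close>. So \<open>x\<close>
      leaves \<open>a\<close> by the same port as \<open>v\<close>, which keeps it on this side and
      makes it a deepest leaf.\<close>
    have "d v x \<noteq> d a v + d a x" using x(2) v(2) False h_pos by auto
    then have hd: "hd (seq T a x) = hd (seq T a v)"
      using diverge_iff[OF ab_nodes(1) n(1) x(1) xa(2,1)] by simp
    then have xs: "x \<in> side a b" using side_iff_hd[OF x(1)] xa p(1) by simp
    then have dx: "d a x = h" using False depth_a[OF xs] dist_commute[OF x(1) ab_nodes(1)] by simp
    define s where "s = take (2 * h - 1) (seq T a x)"
    have s: "s \<in> codes b" "length s = 2 * h - 1" "hd s \<noteq> port T b a"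
      using take_codes[OF sep ab_nodes(1) x(1)] eq p(2) hd h_pos dx by (simp_all add: s_def length_seq hd_take)
    obtain y where y: "y \<in> side b a" "d b y = h" "seq T b y = s @ [0]"
      using S.branch[OF sep s] .
    have "seq T a x = s @ [0]" "degree T x = 1" using leaf_seq[OF xs dx] by (simp_all add: s_def)
    moreover have "degree T y = 1" using S.leaf_seq(1)[OF y(1,2)] .
    ultimately show ?thesis using y by (intro bexI[OF _ side_nodes[OF y(1)]]) simp
  qed
  then obtain y where y: "y \<in> N" "seq T a x = seq T b y" "degree T x = degree T y" by blast
  have "seq T v x = seq T w y"
    unfolding seq_between[OF ab_nodes(1) n(1) x(1)] seq_between[OF ab_nodes(2) n(2) y(1)] vw y(2) ..
  then show ?thesis using y by blast
qed

text \<open>An endless path that does not cross can be prolonged to length \<open>2 * h\<close>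
  within its side, which gives two nodes of depth \<open>h\<close> behind different ports of
  \<open>a\<close>. Neither port is central at \<open>a\<close>, and at least one differs from the
  central port of \<open>b\<close>.\<close>

lemma third_port:
  assumes sep: "\<not> separated T"
    and v: "v \<in> side a b" and z: "z \<in> ends v" "z \<in> side a b" and h: "h > 1"
  shows "\<exists>s\<in>codes a. length s = 2 * h - 1 \<and> hd s \<noteq> port T a b \<and> hd s \<noteq> port T b a"
proof -
  have n: "v \<in> N" "z \<in> N" "d v z = 2 * h - 1" "degree T z \<noteq> 1" using v z side_nodes by (auto simp: ends_def)
  have "v \<noteq> z" using n(1,3) h_pos by auto
  then obtain x where x: "adj z x" "path v x = path v z @ [x]" using degree_eq_1[OF n(1,2)] n(4) by blast
  have xn: "x \<in> N" using adj_nodes x by blast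
  have dvx: "d v x = 2 * h" using dist_step[OF n(1,2) x(2)] n(3) h_pos by simp
  have va: "d v a \<le> h" using depth_a[OF v] .
  have "x \<in> side a b"
  proof (rule ccontr)
    assume "x \<notin> side a b"
    then have "z = a" using adj_across(1)[OF adj_ab x(1) z(2)] sides xn by blast
    then show False using n(3) va h by simp
  qed
  have comm: "d a v = d v a" "d a x = d x a" using dist_commute n xn ab_nodes by auto
  have dx: "d x a \<le> h" using depth_a[OF \<open>x \<in> side a b\<close>] .
  have da: "d a v = h" "d a x = h"
    using dist_triangle[OF n(1) ab_nodes(1) xn] dvx va dx comm by auto
  have ne: "a \<noteq> v" "a \<noteq> x" using da h ab_nodes by auto
  have "hd (seq T a v) \<noteq> hd (seq T a x)"
    using diverge_iff[OF ab_nodes(1) n(1) xn ne] dvx da by simp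
  moreover have "hd (seq T a v) \<noteq> port T a b" "hd (seq T a x) \<noteq> port T a b"
    using side_iff_hd n xn ne v \<open>x \<in> side a b\<close> by auto
  ultimately obtain y where y: "y \<in> N" "d a y = h" "hd (seq T a y) \<noteq> port T a b" "hd (seq T a y) \<noteq> port T b a"
    using n xn da by metis
  then show ?thesis
    using take_codes[OF sep ab_nodes(1) y(1)] h_pos
    by (intro bexI[of _ "take (2 * h - 1) (seq T a y)"]) (simp_all add: length_seq hd_take)
qed

text \<open>The tree is a double star. Codes have length at most 1, so equal codes mean equal
  degrees, and the number of nodes is twice that degree. It is at least 4 and not 4, so the degree
  is at least 3 and exceeds the number of central ports.\<close>

lemma third_port_star:
  assumes sep: "\<not> separated T" and eq: "codes a = codes b" and h: "h = 1" and four: "card N \<noteq> 4"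
  shows "\<exists>s\<in>codes a. length s = 2 * h - 1 \<and> hd s \<noteq> port T a b \<and> hd s \<noteq> port T b a"
proof -
  have dc: "{..<degree T c} = {q. [q] \<in> codes c}" if "c \<in> N" for c
    using degree_not_separated[OF sep that that] that h by simp
  have deg: "degree T a = degree T b" using dc[OF ab_nodes(1)] dc[OF ab_nodes(2)] eq by (metis card_lessThan)
  have adjc: "adj w c" if w: "w \<in> side c e" "d w c \<le> 1" "w \<noteq> c" "c \<in> N" for w c e
  proof -
    have wn: "w \<in> N" using w side_nodes by blast
    obtain y where y: "adj y c" "path w c = path w y @ [c]" "y \<in> N" using path_last_step[OF wn w(4,3)] .
    then have "d w y = 0" using dist_step[OF wn y(3,2)] w(2) by simp
    then show ?thesis using dist_eq_0[OF wn y(3)] y(1) by simp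
  qed
  have "adj a w \<or> adj b w" if w: "w \<in> N" for w
  proof (cases "w = a \<or> w = b")
    case True
    then show ?thesis using adj_ab adj_ba by blast
  next
    case False
    then show ?thesis
      using sides[OF w] adjc[of w a b] adjc[of w b a] depth_a[of w] depth_b[of w] h ab_nodes
        adj_commute[of w a] adj_commute[of w b] by auto
  qed
  then have "N = nbrs T a \<union> nbrs T b" using adj_nodes by (auto simp: nbrs_def)
  moreover have "nbrs T a \<inter> nbrs T b = {}"
  proof (rule ccontr)
    assume "nbrs T a \<inter> nbrs T b \<noteq> {}"
    then obtain w where w: "adj a w" "adj b w" by (auto simp: nbrs_def)
    then have "path a w = [a, w]" "path b w = [b, w]" "w \<in> N" using path_adj adj_nodes by blast+
    then have "d w a = 1" "d w b = 1"
      using dist_commute[of w a] dist_commute[of w b] ab_nodes by (simp_all add: tdist_def)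
    then show False using sides[OF \<open>w \<in> N\<close>] side_dist[OF adj_ab, of w] side_dist[OF adj_ba, of w] by auto
  qed
  ultimately have "card N = degree T a + degree T b"
    unfolding degree_def by (simp add: card_Un_disjoint finite_nbrs)
  then have "degree T a \<ge> 3" using deg four diameter_less diam h by simp
  moreover have "card {port T a b, port T b a} \<le> 2" by (simp add: card_insert_if)
  ultimately have "\<not> {..<degree T a} \<subseteq> {port T a b, port T b a}"
    using card_mono[of "{port T a b, port T b a}" "{..<degree T a}"] by auto
  then obtain q where "[q] \<in> codes a" "q \<noteq> port T a b" "q \<noteq> port T b a" using dc[OF ab_nodes(1)] by blast
  then show ?thesis using h by (intro bexI[of _ "[q]"]) simp_all
qed

lemma codes_differ_not_separated:
  assumes sep: "\<not> separated T" and feas: "feasible_with_map T r" and r: "r \<le> 2 * h - 1" and four: "card N \<noteq> 4"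
  shows "codes a \<noteq> codes b"
proof
  interpret S: central_tree T b a h by (rule swap)
  assume eq: "codes a = codes b"
  have "\<exists>s\<in>codes a. length s = 2 * h - 1 \<and> hd s \<noteq> port T a b \<and> hd s \<noteq> port T b a"
  proof (cases "h = 1")
    case True
    then show ?thesis using third_port_star[OF sep eq _ four] by blast
  next
    case False
    then have h: "h > 1" using h_pos by simp
    \<comment> \<open>By \<open>separatedI\<close>, lack of separation shows in an endless path that
      ends on the side where it starts.\<close>
    obtain v z where "z \<in> ends v" "v \<in> side a b \<and> z \<notin> side b a \<or> v \<in> side b a \<and> z \<notin> side a b"
      using separatedI sep by blast
    then have "z \<in> ends v" "v \<in> side a b \<and> z \<in> side a b \<or> v \<in> side b a \<and> z \<in> side b a"
      using sides[of z] by (auto simp: ends_def)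
    then show ?thesis using third_port[OF sep _ _ _ h] S.third_port[OF sep _ _ _ h] eq by blast
  qed
  then obtain s where s: "s \<in> codes a" "length s = 2 * h - 1" "hd s \<noteq> port T a b" "hd s \<noteq> port T b a" by blast
  obtain v where v: "v \<in> side a b" "d v a = h" "d a v = h" "seq T a v = s @ [0]" "hd (seq T a v) = hd s"
    using branch[OF sep s(1-3)] .
  obtain w where w: "w \<in> side b a" "d w b = h" "d b w = h" "seq T b w = s @ [0]" "hd (seq T b w) = hd s"
    using S.branch[OF sep _ s(2,4)] s(1) eq by blast
  have vw: "seq T a v = seq T b w" using v w by simp
  have "view T v r = view T w r"
  proof (rule view_eqI)
    show "v \<in> N" "w \<in> N" using v w side_nodes by auto
    show "\<exists>y\<in>N. seq T v x = seq T w y \<and> degree T x = degree T y" if "x \<in> N" "d v x \<le> r" for x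
      using not_separated_alike[OF sep eq v(1,3) w(1) vw _ _ that(1)] v(5) s(3,4) that(2) r by simp
    show "\<exists>y\<in>N. seq T w x = seq T v y \<and> degree T x = degree T y" if "x \<in> N" "d w x \<le> r" for x
      using S.not_separated_alike[OF sep eq[symmetric] w(1,3) v(1) vw[symmetric] _ _ that(1)] w(5) s(3,4) that(2) r
      by simp
  qed
  then show False using opposite_views_differ[OF v(1) w(1) _ feas] v(2) w(2) by simp
qed

lemma advised_tree_exists:
  assumes "s \<in> codes a" "s \<notin> codes b"
  shows "\<exists>adv s t. advised_tree T a b h adv s t"
proof -
  obtain i where i: "i < length (oracle_list T a)" "oracle_list T a ! i = s"
    using assms(1) set_oracle_list[OF ab_nodes(1)] by (metis in_set_conv_nth)
  define t where "t = jth (oracle_list T b) (Suc i)"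
  define k where "k = (GREATEST k. k \<le> length s \<and> k \<le> length t \<and> take k s = take k t)"
  define adv where "adv = \<lparr>adv_D = diameter T, adv_sep = separated T, adv_j = Suc i, adv_k = k,
    adv_m = s ! k, adv_p = port T b a\<rparr>"
  have "advised_tree T a b h adv s t"
    using i assms(2) set_oracle_list[OF ab_nodes(2)]
    by unfold_locales (simp_all add: adv_def t_def k_def jth_def)
  then show ?thesis by blast
qed

end

theorem theorem4p2:
  shows "\<exists>C::real. \<forall>T::'a ptree.
    port_tree T \<and> nonsymmetric T \<and> odd (diameter T) \<and> xi T + 2 \<le> diameter T \<longrightarrow>
      (card (nodes T) \<noteq> 4 \<longrightarrow> (\<exists>A. OddElect_advice T A)) \<and>
      (\<forall>A. OddElect_advice T A \<longrightarrow>
         real (length A) \<le> C * log 2 (real (card (nodes T))) \<and>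
         OddElect_rounds A = diameter T - 2 \<and>
         leader_election T (\<lambda>v. OddElect A (view T v (OddElect_rounds A))))"
proof (rule exI[of _ 50], intro allI impI conjI)
  fix T :: "'a ptree"
  assume T: "port_tree T \<and> nonsymmetric T \<and> odd (diameter T) \<and> xi T + 2 \<le> diameter T"
  then interpret tree T by unfold_locales simp
  obtain a b h where "central_tree T a b h" using central_tree_exists T by auto
  then interpret central_tree T a b h .
  interpret S: central_tree T b a h by (rule swap)
  {
    assume four: "card (nodes T) \<noteq> 4"
    have "feasible_with_map T (xi T)" "xi T \<le> 2 * h - 1" using feasible_xi T diam by auto
    then have "codes a \<noteq> codes b"
      using codes_differ_separated codes_differ_not_separated[OF _ _ _ four] by blast
    then consider s where "s \<in> codes a" "s \<notin> codes b" | s where "s \<in> codes b" "s \<notin> codes a" by blast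
    then have "\<exists>adv s t. advised_tree T a b h adv s t \<or> advised_tree T b a h adv s t"
      using advised_tree_exists S.advised_tree_exists by metis
    then show "\<exists>A. OddElect_advice T A" using advice_for_iff unfolding OddElect_advice_def by blast
  }
  fix A assume "OddElect_advice T A"
  then obtain adv where A: "A = enc_advice adv" "advice_for T adv" by (auto simp: OddElect_advice_def)
  then obtain x y s t where "advised_tree T x y h adv s t" using advice_for_iff by blast
  then interpret X: advised_tree T x y h adv s t .
  \<comment> \<open>The diameter is at least 3; four nodes are what the logarithmic bound on the
    length requires.\<close>
  have "card (nodes T) \<ge> 4" using diameter_less diam h_pos by simp
  then show "real (length A) \<le> 50 * log 2 (real (card (nodes T)))"
    unfolding A(1) using X.advice_bounds by (rule length_enc_advice)
  show rounds: "OddElect_rounds A = diameter T - 2"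
    by (simp add: OddElect_rounds_def A(1) dec_enc_advice X.adv_D)
  show "leader_election T (\<lambda>v. OddElect A (view T v (OddElect_rounds A)))"
    unfolding rounds using X.leader A(1) by simp
qed

end
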